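(* For any Eulerian graph $G$: (1) $c_{2,\mathrm{top}}(G) = \frac{\Delta(G)}{2}$, provided $G$ is not a union of two or more vertex-disjoint cycles; (2) $c_{2,\mathrm{iso}}(G) \leq \mathrm{la}(G)$; (3) $c_2(G) \leq \Delta(G)$.
   Context: All graphs are finite and simple. A graph is Eulerian if every vertex has even degree (not necessarily connected). For an Eulerian graph $G=(V,E)$, a cycle odd-cover of $G$ is a collection of cycles in the complete graph on $V$ whose edge sets have symmetric difference equal to $E$; $c_2(G)$ is the minimum cardinality of a cycle odd-cover. $c_{2,\mathrm{top}}(G)$ is the minimum of $c_2(H)$ over all subdivisions $H$ of $G$ (including $G$). $c_{2,\mathrm{iso}}(G)$ is the minimum of $c_2(H)$ over all graphs $H$ obtained from $G$ by adding (any number of) isolated vertices. $\Delta(G)$ is the maximum degree. A linear forest is a graph each of whose components is a path; $\mathrm{la}(G)$ is the minimum number of edge-disjoint linear forests whose union is $E(G)$.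
   Formalization: In (1) the excluded graphs are unions of two or more vertex-disjoint cycles together with any number of isolated vertices; for two disjoint triangles plus an isolated vertex, the claim as literally stated fails. *)

theory Defs
  imports Main "HOL-Library.Extended_Nat" "HOL-Library.Disjoint_Sets"
begin

datatype 'a graph = Graph (verts: "'a set") (edges: "'a set set")

definition simple_graph :: "'a graph \<Rightarrow> bool" where
  "simple_graph G \<longleftrightarrow> finite (verts G) \<and> (\<forall>e\<in>edges G. e \<subseteq> verts G \<and> card e = 2)"

definition degree :: "'a graph \<Rightarrow> 'a \<Rightarrow> nat" where
  "degree G v = card {e \<in> edges G. v \<in> e}"

text \<open>The inserted 0 only matters for the graph without vertices.\<close>

definition max_degree :: "'a graph \<Rightarrow> nat" where
  "max_degree G = Max (insert 0 (degree G ` verts G))"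

definition eulerian :: "'a graph \<Rightarrow> bool" where
  "eulerian G \<longleftrightarrow> (\<forall>v\<in>verts G. even (degree G v))"

text \<open>A path is given by the list of its vertices, a cycle by the list of its vertices in cyclic
  order. A cycle has at least three vertices and is identified with its set of edges, so that
  its vertex set is the union of that set.\<close>

definition path_edges :: "'a list \<Rightarrow> 'a set set" where
  "path_edges vs = {{vs ! i, vs ! Suc i} | i. Suc i < length vs}"

definition cycle_on :: "'a set \<Rightarrow> 'a set set \<Rightarrow> bool" where
  "cycle_on V C \<longleftrightarrow>
     (\<exists>vs. distinct vs \<and> 3 \<le> length vs \<and> set vs \<subseteq> V \<and>
           C = insert {last vs, hd vs} (path_edges vs))"

text \<open>The symmetric difference of a finite family consists of the elements that lie in an odd
  number of its members. Repeated cycles would cancel in pairs, so sets of cycles are enough for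
  the minimum cardinality.

  Minima are taken in the extended naturals: a minimum over no candidates would be infinite, so
  finiteness is part of every equation or upper bound by a natural number.\<close>

definition cycle_odd_cover :: "'a graph \<Rightarrow> 'a set set set \<Rightarrow> bool" where
  "cycle_odd_cover G \<C> \<longleftrightarrow>
     finite \<C> \<and> (\<forall>C\<in>\<C>. cycle_on (verts G) C) \<and> {e. odd (card {C \<in> \<C>. e \<in> C})} = edges G"

definition c2 :: "'a graph \<Rightarrow> enat" where
  "c2 G = (INF \<C> \<in> {\<C>. cycle_odd_cover G \<C>}. enat (card \<C>))"

inductive subdivision :: "'a graph \<Rightarrow> 'a graph \<Rightarrow> bool" for G where
  subdivision_refl: "subdivision G G"
| subdivision_step: "subdivision G H \<Longrightarrow> {u, v} \<in> edges H \<Longrightarrow> w \<notin> verts H \<Longrightarrow>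
    subdivision G (Graph (insert w (verts H)) (edges H - {{u, v}} \<union> {{u, w}, {w, v}}))"

text \<open>The vertex type of a graph may be finite. Graphs with additional vertices therefore live on
  a larger type, which provides infinitely many unused vertices.\<close>

definition embed :: "'a graph \<Rightarrow> ('a + nat) graph" where
  "embed G = Graph (Inl ` verts G) ((`) Inl ` edges G)"

definition c2_top :: "'a graph \<Rightarrow> enat" where
  "c2_top G = (INF H \<in> {H. subdivision (embed G) H}. c2 H)"

definition c2_iso :: "'a graph \<Rightarrow> enat" where
  "c2_iso G = (INF W \<in> {W. finite W \<and> verts (embed G) \<subseteq> W}. c2 (Graph W (edges (embed G))))"

definition component :: "'a graph \<Rightarrow> 'a \<Rightarrow> 'a set" where
  "component G v = {w. (v, w) \<in> {(x, y). {x, y} \<in> edges G}\<^sup>*}"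

text \<open>A single vertex is a path, so isolated vertices are allowed in a linear forest. Hence it does
  not matter that the forests in the definition of the linear arboricity are taken to be
  spanning subgraphs.\<close>

definition linear_forest :: "'a graph \<Rightarrow> bool" where
  "linear_forest G \<longleftrightarrow> simple_graph G \<and>
     (\<forall>v\<in>verts G. \<exists>vs. distinct vs \<and> set vs = component G v \<and>
        path_edges vs = {e \<in> edges G. e \<subseteq> component G v})"

definition la :: "'a graph \<Rightarrow> enat" where
  "la G = (INF \<F> \<in> {\<F>. finite \<F> \<and> disjoint \<F> \<and> \<Union>\<F> = edges G \<and>
                         (\<forall>F\<in>\<F>. linear_forest (Graph (verts G) F))}. enat (card \<F>))"

text \<open>Isolated vertices are disregarded here: two disjoint triangles together with an isolated
  vertex count as a union of two vertex-disjoint cycles. No subdivision of that graph is a single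
  cycle up to isolated vertices, so it has to be excluded just like the two triangles alone.\<close>

definition union_of_disjoint_cycles :: "'a graph \<Rightarrow> bool" where
  "union_of_disjoint_cycles G \<longleftrightarrow>
     (\<exists>\<C>. finite \<C> \<and> 2 \<le> card \<C> \<and> (\<forall>C\<in>\<C>. cycle_on (verts G) C) \<and>
          pairwise (\<lambda>C D. \<Union>C \<inter> \<Union>D = {}) \<C> \<and> \<Union>\<C> = edges G)"

text \<open>In particular, halving the maximum degree of an Eulerian graph by integer division is exact.\<close>

lemma eulerian_even_max_degree:
  assumes "simple_graph G" "eulerian G"
  shows "even (max_degree G)"
proof -
  have "max_degree G \<in> insert 0 (degree G ` verts G)"
    unfolding max_degree_def using assms(1) by (intro Max_in) (auto simp: simple_graph_def)
  then show ?thesis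
    using assms(2) by (auto simp: eulerian_def)
qed

end

theory Submission
  imports Defs "HOL-Combinatorics.Cycles" "HOL-Library.Multiset"
begin

text \<open>An Eulerian graph has a balanced orientation, and by Hall's theorem its arcs split into
  \<open>\<Delta> / 2\<close> permutations; so the edge set splits into \<open>\<Delta> / 2\<close> systems of disjoint cycles.
  A system of at least two cycles is the sum of two cycles: delete an edge of each cycle, close the
  resulting paths up to one cycle in some order, and add the cycle that consists of the deleted edges
  and the new ones. This bounds \<open>c\<^sub>2\<close>. If every cycle has a subdivided edge of its own, then this
  second cycle consists of vertices that the other systems avoid. It can be passed on from system to
  system, and the last two systems are closed with the same new edges, so one cycle per system
  suffices.

  For linear forests the end vertices are handled in the same spirit: the paths of one forest are
  closed to a cycle through new vertices, and the edges added are distributed over the other forests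
  so that these remain linear. For the last two forests, which have the same ends, common new edges
  complete both to a single cycle.\<close>

section \<open>Edge multisets of paths and cycles\<close>

text \<open>Sums are kept as multisets of edges and compared by odd multiplicities, so an edge that
  is added twice may be any edge, even one of the graph. The lower bound for subdivisions rests on
  two facts: a cycle has at most two edges at a vertex, and subdividing keeps the degrees of old
  vertices. In the upper bound, the cycle passed on must avoid the next system. Subdividing an edge
  of every cycle twice yields a deleted edge with both ends new. A single system has no successor to
  receive its second cycle, whence the exception for disjoint cycles. For linear forests, evenness
  of the degrees says that every vertex is an end of evenly many forests. Two forests thus have the
  same ends, and with more forests an end of the first is an end of another one, which can take up
  an edge there. A detour through one new vertex could close a cycle if one forest takes both of its
  edges; two new vertices leave a middle edge that can go elsewhere. This takes two further forests,
  so the last two need their own argument.\<close>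

fun path_mset :: "'a list \<Rightarrow> 'a set multiset" where
  "path_mset [] = {#}"
| "path_mset [x] = {#}"
| "path_mset (x # y # zs) = add_mset {x, y} (path_mset (y # zs))"

definition cycle_mset :: "'a list \<Rightarrow> 'a set multiset" where
  "cycle_mset c = add_mset {last c, hd c} (path_mset c)"

lemma path_mset_append:
  assumes "xs \<noteq> []" "ys \<noteq> []"
  shows "path_mset (xs @ ys) = add_mset {last xs, hd ys} (path_mset xs + path_mset ys)"
  using assms(1)
proof (induction xs rule: path_mset.induct)
  case (2 x)
  obtain y zs where "ys = y # zs" using assms(2) by (cases ys) auto
  then show ?case by simp
qed auto

lemma path_mset_Cons: "ys \<noteq> [] \<Longrightarrow> path_mset (x # ys) = add_mset {x, hd ys} (path_mset ys)"
  using path_mset_append[of "[x]" ys] by simp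

lemma path_mset_snoc: "xs \<noteq> [] \<Longrightarrow> path_mset (xs @ [y]) = add_mset {last xs, y} (path_mset xs)"
  using path_mset_append[of xs "[y]"] by simp

lemma path_mset_rev [simp]: "path_mset (rev xs) = path_mset xs"
proof (induction xs rule: path_mset.induct)
  case (3 x y zs)
  then show ?case
    using path_mset_append[of "rev (y # zs)" "[x]"] by (simp add: last_rev insert_commute)
qed auto

lemma path_edges_Cons_Cons: "path_edges (x # y # zs) = insert {x, y} (path_edges (y # zs))"
proof (intro set_eqI iffI)
  fix e assume "e \<in> path_edges (x # y # zs)"
  then obtain i where i: "e = {(x # y # zs) ! i, (x # y # zs) ! Suc i}" "Suc i < length (x # y # zs)"
    unfolding path_edges_def by blast
  then show "e \<in> insert {x, y} (path_edges (y # zs))"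
    by (cases i) (auto simp: path_edges_def)
next
  fix e assume "e \<in> insert {x, y} (path_edges (y # zs))"
  then consider "e = {x, y}" | i where "e = {(y # zs) ! i, (y # zs) ! Suc i}" "Suc i < length (y # zs)"
    unfolding path_edges_def by blast
  then show "e \<in> path_edges (x # y # zs)"
  proof cases
    case 1
    then show ?thesis unfolding path_edges_def by (intro CollectI exI[of _ 0]) auto
  next
    case 2
    then show ?thesis unfolding path_edges_def by (intro CollectI exI[of _ "Suc i"]) auto
  qed
qed

lemma set_path_mset: "set_mset (path_mset p) = path_edges p"
proof (induction p rule: path_mset.induct)
  case (3 x y zs)
  then show ?case by (simp add: path_edges_Cons_Cons)
qed (auto simp: path_edges_def)

lemma path_mset_edge_subset: "e \<in># path_mset p \<Longrightarrow> e \<subseteq> set p"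
  by (induction p rule: path_mset.induct) auto

lemma count_path_mset_le_1: "distinct p \<Longrightarrow> count (path_mset p) e \<le> 1"
proof (induction p rule: path_mset.induct)
  case (3 x y zs)
  have "{x, y} \<notin># path_mset (y # zs)"
    using 3(2) path_mset_edge_subset[of "{x, y}" "y # zs"] by auto
  then show ?case using 3 by (auto simp: not_in_iff)
qed auto

lemma mset_set_eqI:
  assumes "\<And>e. count M e \<le> 1" shows "M = mset_set (set_mset M)"
proof (rule multiset_eqI)
  fix e
  show "count M e = count (mset_set (set_mset M)) e"
    using assms[of e] by (cases "e \<in># M") (auto simp: le_Suc_eq simp flip: not_in_iff)
qed

lemma path_mset_distinct: "distinct p \<Longrightarrow> path_mset p = mset_set (path_edges p)"
  using mset_set_eqI[OF count_path_mset_le_1] by (simp add: set_path_mset)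

lemma cycle_mset_Cons: "cycle_mset (x # xs) = path_mset (x # xs @ [x])"
  using path_mset_append[of "x # xs" "[x]"] by (simp add: cycle_mset_def)

text \<open>The first vertex lies on a single path edge, the one to the second vertex, and with
  three vertices that is not the last one. For \<open>[a, b]\<close> the closing edge would repeat
  the path edge.\<close>

lemma closing_edge_notin_path_mset:
  assumes "distinct c" "3 \<le> length c"
  shows "{last c, hd c} \<notin># path_mset c"
proof
  assume a: "{last c, hd c} \<in># path_mset c"
  from assms(2) obtain x y d' where c: "c = x # y # d'" "d' \<noteq> []"
    by (auto simp: numeral_3_eq_3 Suc_le_length_iff)
  define d where "d = y # d'"
  have l: "last c = last d'" "hd c = x" using c by auto
  have "{last d', x} = {x, y} \<or> {last d', x} \<in># path_mset d"
    using a unfolding l by (auto simp: c d_def)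
  then show False
    using assms(1) c d_def path_mset_edge_subset[of "{last d', x}" d] by (auto simp: doubleton_eq_iff)
qed

lemma cycle_mset_distinct:
  assumes "distinct c" "3 \<le> length c"
  shows "cycle_mset c = mset_set (insert {last c, hd c} (path_edges c))"
proof -
  have "finite (path_edges c)" by (simp flip: set_path_mset)
  then show ?thesis
    using closing_edge_notin_path_mset[OF assms] assms
    by (simp add: cycle_mset_def path_mset_distinct set_path_mset)
qed

lemma cycle_mset_edge_subset: "c \<noteq> [] \<Longrightarrow> e \<in># cycle_mset c \<Longrightarrow> e \<subseteq> set c"
  using path_mset_edge_subset by (auto simp: cycle_mset_def)

subsection \<open>Sums of cycles modulo two\<close>

definition odd_part :: "'a multiset \<Rightarrow> 'a set" where
  "odd_part M = {x. odd (count M x)}"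

lemma odd_part_empty [simp]: "odd_part {#} = {}"
  by (simp add: odd_part_def)

lemma odd_part_mset_set [simp]: "finite A \<Longrightarrow> odd_part (mset_set A) = A"
  by (auto simp: odd_part_def count_mset_set')

lemma odd_part_double [simp]: "odd_part (M + X + X) = odd_part M"
  by (auto simp: odd_part_def)

lemma odd_part_add_cong:
  "odd_part M = odd_part M' \<Longrightarrow> odd_part N = odd_part N' \<Longrightarrow> odd_part (M + N) = odd_part (M' + N')"
  by (auto simp: odd_part_def set_eq_iff)

definition is_cycle :: "'a set \<Rightarrow> 'a list \<Rightarrow> bool" where
  "is_cycle V c \<longleftrightarrow> distinct c \<and> 3 \<le> length c \<and> set c \<subseteq> V"

text \<open>A list with a bound on its length makes covers concatenable and monotone; repeated
  cycles are cancelled only in \<open>c2_le_covered\<close>. The cycles may use edges outside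
  \<open>M\<close>.\<close>

definition covered :: "'a set \<Rightarrow> nat \<Rightarrow> 'a set multiset \<Rightarrow> bool" where
  "covered V n M \<longleftrightarrow> (\<exists>Cs. length Cs \<le> n \<and> (\<forall>c\<in>set Cs. is_cycle V c) \<and>
     odd_part (\<Sum>c\<leftarrow>Cs. cycle_mset c) = odd_part M)"

lemma covered_empty [simp]: "covered V n {#}"
  unfolding covered_def by (rule exI[of _ "[]"]) simp

lemma covered_cong: "odd_part M = odd_part N \<Longrightarrow> covered V n M \<longleftrightarrow> covered V n N"
  by (simp add: covered_def)

lemma covered_mono: "covered V n M \<Longrightarrow> n \<le> m \<Longrightarrow> V \<subseteq> W \<Longrightarrow> covered W m M"
  unfolding covered_def is_cycle_def by (meson order_trans)

lemma covered_cycle: "is_cycle V c \<Longrightarrow> covered V 1 (cycle_mset c)"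
  unfolding covered_def by (rule exI[of _ "[c]"]) simp

lemma covered_add: "covered V m M \<Longrightarrow> covered V n N \<Longrightarrow> covered V (m + n) (M + N)"
  unfolding covered_def
proof (elim exE conjE)
  fix Cs Ds
  assume "length Cs \<le> m" "\<forall>c\<in>set Cs. is_cycle V c" "odd_part (\<Sum>c\<leftarrow>Cs. cycle_mset c) = odd_part M"
    "length Ds \<le> n" "\<forall>c\<in>set Ds. is_cycle V c" "odd_part (\<Sum>c\<leftarrow>Ds. cycle_mset c) = odd_part N"
  then show "\<exists>Cs. length Cs \<le> m + n \<and> (\<forall>c\<in>set Cs. is_cycle V c) \<and>
      odd_part (\<Sum>c\<leftarrow>Cs. cycle_mset c) = odd_part (M + N)"
    by (intro exI[of _ "Cs @ Ds"]) (auto intro!: odd_part_add_cong)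
qed

text \<open>Induction over the list toggles the membership of each cycle in the family: a cycle
  already present is removed. Parities agree with the list sum and the family never outgrows the
  list.\<close>

lemma c2_le_covered:
  assumes "covered (verts G) n M" "odd_part M = edges G"
  shows "c2 G \<le> enat n"
proof -
  have ex: "\<exists>\<C>. finite \<C> \<and> card \<C> \<le> length Cs \<and> (\<forall>C\<in>\<C>. cycle_on V C) \<and>
      {e. odd (card {C \<in> \<C>. e \<in> C})} = odd_part (\<Sum>c\<leftarrow>Cs. cycle_mset c)"
    if "\<forall>c\<in>set Cs. is_cycle V c" for V :: "'a set" and Cs
    using that
  proof (induction Cs)
    case Nil
    show ?case by (rule exI[of _ "{}"]) auto
  next
    case (Cons c Cs)
    then obtain \<C> where \<C>: "finite \<C>" "card \<C> \<le> length Cs" "\<forall>C\<in>\<C>. cycle_on V C"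
      "{e. odd (card {C \<in> \<C>. e \<in> C})} = odd_part (\<Sum>c\<leftarrow>Cs. cycle_mset c)"
      by auto
    define C where "C = insert {last c, hd c} (path_edges c)"
    have c: "distinct c" "3 \<le> length c" "set c \<subseteq> V" using Cons.prems by (auto simp: is_cycle_def)
    have fin: "finite C" unfolding C_def by (simp flip: set_path_mset)
    have cnt: "count (cycle_mset c) e = of_bool (e \<in> C)" for e
      using cycle_mset_distinct[OF c(1,2)] fin by (simp add: C_def count_mset_set')
    have on: "cycle_on V C" unfolding cycle_on_def C_def using c by blast
    define \<D> where "\<D> = (if C \<in> \<C> then \<C> - {C} else insert C \<C>)"
    have par: "odd (card {D \<in> \<D>. e \<in> D}) \<longleftrightarrow> odd (card {D \<in> \<C>. e \<in> D}) \<noteq> (e \<in> C)" for e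
    proof (cases "e \<in> C")
      case False
      then have "{D \<in> \<D>. e \<in> D} = {D \<in> \<C>. e \<in> D}" by (auto simp: \<D>_def)
      then show ?thesis using False by simp
    next
      case True
      show ?thesis
      proof (cases "C \<in> \<C>")
        case in\<C>: True
        have "{D \<in> \<C>. e \<in> D} = insert C {D \<in> \<D>. e \<in> D}" "C \<notin> {D \<in> \<D>. e \<in> D}"
          using True in\<C> by (auto simp: \<D>_def)
        then have "card {D \<in> \<C>. e \<in> D} = Suc (card {D \<in> \<D>. e \<in> D})"
          using \<C>(1) by (simp add: \<D>_def)
        then show ?thesis using True by simp
      next
        case notin: False
        have "{D \<in> \<D>. e \<in> D} = insert C {D \<in> \<C>. e \<in> D}"
          using True notin by (auto simp: \<D>_def)
        then have "card {D \<in> \<D>. e \<in> D} = Suc (card {D \<in> \<C>. e \<in> D})"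
          using \<C>(1) notin by simp
        then show ?thesis using True by simp
      qed
    qed
    have "finite \<D>" "card \<D> \<le> length (c # Cs)" "\<forall>C\<in>\<D>. cycle_on V C"
      using \<C>(1-3) on by (auto simp: \<D>_def card_insert_if intro: le_trans[OF card_Diff1_le])
    moreover have "{e. odd (card {D \<in> \<D>. e \<in> D})} = odd_part (\<Sum>c\<leftarrow>c # Cs. cycle_mset c)"
      using \<C>(4) unfolding par by (auto simp: odd_part_def cnt set_eq_iff)
    ultimately show ?case by blast
  qed
  from assms(1) obtain Cs where Cs: "length Cs \<le> n" "\<forall>c\<in>set Cs. is_cycle (verts G) c"
    "odd_part (\<Sum>c\<leftarrow>Cs. cycle_mset c) = odd_part M"
    unfolding covered_def by blast
  obtain \<C> where \<C>: "finite \<C>" "card \<C> \<le> length Cs" "\<forall>C\<in>\<C>. cycle_on (verts G) C"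
      "{e. odd (card {C \<in> \<C>. e \<in> C})} = odd_part (\<Sum>c\<leftarrow>Cs. cycle_mset c)"
    using ex[OF Cs(2)] by blast
  have "cycle_odd_cover G \<C>"
    unfolding cycle_odd_cover_def using \<C> Cs(3) assms(2) by simp
  then have "c2 G \<le> enat (card \<C>)"
    unfolding c2_def by (intro INF_lower) simp
  also have "\<dots> \<le> enat n" using \<C>(2) Cs(1) by simp
  finally show ?thesis .
qed

text \<open>Two closed walks through the same end vertices in the same order use the same edges between
  consecutive segments, so these edges cancel.\<close>

lemma cycle_mset_concat_pair:
  fixes f g :: "'b \<Rightarrow> 'a list"
  assumes "\<forall>i\<in>set is. f i \<noteq> [] \<and> g i \<noteq> [] \<and> hd (f i) = hd (g i) \<and> last (f i) = last (g i)"
    and "is \<noteq> []"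
  shows "\<exists>X. cycle_mset (concat (map f is)) + cycle_mset (concat (map g is)) =
     (\<Sum>i\<leftarrow>is. path_mset (f i) + path_mset (g i)) + X + X"
proof -
  have "hd (concat (map f is)) = hd (concat (map g is)) \<and>
      last (concat (map f is)) = last (concat (map g is)) \<and>
      (\<exists>X. path_mset (concat (map f is)) + path_mset (concat (map g is)) =
     (\<Sum>i\<leftarrow>is. path_mset (f i) + path_mset (g i)) + X + X)"
    using assms
  proof (induction "is")
    case (Cons i "is")
    show ?case
    proof (cases "is = []")
      case True
      then show ?thesis using Cons.prems by (auto intro: exI[of _ "{#}"])
    next
      case False
      with Cons obtain X where X: "hd (concat (map f is)) = hd (concat (map g is))"
        "last (concat (map f is)) = last (concat (map g is))"
        "path_mset (concat (map f is)) + path_mset (concat (map g is)) =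
         (\<Sum>i\<leftarrow>is. path_mset (f i) + path_mset (g i)) + X + X"
        by auto
      have ne: "concat (map f is) \<noteq> []" "concat (map g is) \<noteq> []"
        using False Cons.prems by (cases "is"; auto)+
      have "path_mset (f i @ concat (map f is)) + path_mset (g i @ concat (map g is)) =
          path_mset (f i) + path_mset (g i) + (path_mset (concat (map f is)) + path_mset (concat (map g is)))
          + {#{last (f i), hd (concat (map f is))}#} + {#{last (f i), hd (concat (map f is))}#}"
        using path_mset_append[of "f i" "concat (map f is)"]
          path_mset_append[of "g i" "concat (map g is)"] ne Cons.prems(1) X(1)
        by (simp add: ac_simps)
      then have "path_mset (concat (map f (i # is))) + path_mset (concat (map g (i # is))) =
          (\<Sum>i\<leftarrow>i # is. path_mset (f i) + path_mset (g i))
          + add_mset {last (f i), hd (concat (map f is))} X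
          + add_mset {last (f i), hd (concat (map f is))} X"
        by (simp add: X(3))
      then have "\<exists>X. path_mset (concat (map f (i # is))) + path_mset (concat (map g (i # is))) =
          (\<Sum>i\<leftarrow>i # is. path_mset (f i) + path_mset (g i)) + X + X" by blast
      then show ?thesis using X(1,2) ne Cons.prems(1) by (simp add: hd_append)
    qed
  qed simp
  then obtain X where "hd (concat (map f is)) = hd (concat (map g is))"
      "last (concat (map f is)) = last (concat (map g is))"
      "path_mset (concat (map f is)) + path_mset (concat (map g is)) =
     (\<Sum>i\<leftarrow>is. path_mset (f i) + path_mset (g i)) + X + X" by blast
  \<comment> \<open>The closing edge is shared as well, so it joins the doubled edges collected in
    \<open>X\<close>.\<close>
  then show ?thesis
    by (intro exI[of _ "add_mset {last (concat (map f is)), hd (concat (map f is))} X"])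
      (simp add: cycle_mset_def)
qed

section \<open>Decomposing an Eulerian graph into spanning unions of cycles\<close>

text \<open>Induction on \<open>card I\<close> following Halmos and Vaughan. A proper nonempty tight
  subfamily is matched on its own and its union is withheld from the rest. If there is none, every
  proper nonempty subfamily has an element to spare, so one pair can be fixed arbitrarily.\<close>

lemma hall:
  assumes "finite I" "\<And>i. i \<in> I \<Longrightarrow> finite (A i)" "\<And>J. J \<subseteq> I \<Longrightarrow> card J \<le> card (\<Union>(A ` J))"
  shows "\<exists>f. inj_on f I \<and> (\<forall>i\<in>I. f i \<in> A i)"
  using assms
proof (induction "card I" arbitrary: I A rule: less_induct)
  case less
  note finI = less.prems(1) and finA = less.prems(2) and cond = less.prems(3)
  show ?case
  proof (cases "\<exists>J. J \<subset> I \<and> J \<noteq> {} \<and> card (\<Union>(A ` J)) = card J")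
    case True
    then obtain J where J: "J \<subset> I" "J \<noteq> {}" "card (\<Union>(A ` J)) = card J" by blast
    have finJ: "finite J" using J(1) finI finite_subset by blast
    have "card J < card I" using J(1) finI psubset_card_mono by blast
    then obtain f where f: "inj_on f J" "\<forall>i\<in>J. f i \<in> A i"
      using less.hyps[of J A] finJ finA cond J(1) by (metis order_trans psubset_imp_subset subsetD)
    define U where "U = \<Union>(A ` J)"
    have finU: "finite U" unfolding U_def using finJ finA J(1) by auto
    have "card (I - J) < card I"
      using J(1,2) finI by (intro psubset_card_mono) auto
    moreover have "card K \<le> card (\<Union>((\<lambda>i. A i - U) ` K))" if K: "K \<subseteq> I - J" for K
    proof -
      have finK: "finite K" using K finI finite_subset by blast
      have fin: "finite (\<Union>((\<lambda>i. A i - U) ` K))" using finK finA K by auto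
      \<comment> \<open>Hall's condition for \<open>K\<close> together with the tight
        \<open>J\<close> becomes the condition for \<open>K\<close> after \<open>U\<close> is
        removed.\<close>
      have "card K + card J = card (K \<union> J)"
        using K finK finJ by (subst card_Un_disjoint) auto
      also have "\<dots> \<le> card (\<Union>(A ` (K \<union> J)))" using K J(1) by (intro cond) auto
      also have "\<Union>(A ` (K \<union> J)) = \<Union>((\<lambda>i. A i - U) ` K) \<union> U" by (auto simp: U_def)
      also have "card \<dots> = card (\<Union>((\<lambda>i. A i - U) ` K)) + card U"
        using fin finU by (subst card_Un_disjoint) auto
      finally show ?thesis using J(3) by (simp add: U_def)
    qed
    ultimately obtain g where g: "inj_on g (I - J)" "\<forall>i\<in>I - J. g i \<in> A i - U"
      using less.hyps[of "I - J" "\<lambda>i. A i - U"] finI finA by auto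
    define h where "h i = (if i \<in> J then f i else g i)" for i
    have "h i \<in> A i" if "i \<in> I" for i using that f g by (auto simp: h_def)
    moreover have "inj_on h I"
    proof (rule inj_onI)
      fix i j assume ij: "i \<in> I" "j \<in> I" "h i = h j"
      have U: "h l \<in> U \<longleftrightarrow> l \<in> J" if "l \<in> I" for l
        using that f(2) g(2) by (cases "l \<in> J") (auto simp: h_def U_def)
      show "i = j"
      proof (cases "i \<in> J")
        case True
        then have "j \<in> J" using U ij by metis
        then show ?thesis using True ij(3) inj_onD[OF f(1)] by (simp add: h_def)
      next
        case False
        then have "j \<notin> J" using U ij by metis
        then show ?thesis using False ij inj_onD[OF g(1)] by (simp add: h_def)
      qed
    qed
    ultimately show ?thesis by blast
  next
    case False
    show ?thesis
    proof (cases "I = {}")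
      case nonempty: False
      then obtain i where i: "i \<in> I" by blast
      have "card {i} \<le> card (\<Union>(A ` {i}))" using i by (intro cond) auto
      then obtain x where x: "x \<in> A i" by fastforce
      have "card (I - {i}) < card I" using i finI by (simp add: card_gt_0_iff nonempty)
      moreover have "card K \<le> card (\<Union>((\<lambda>j. A j - {x}) ` K))" if K: "K \<subseteq> I - {i}" for K
      proof (cases "K = {}")
        case K0: False
        have "card K \<le> card (\<Union>(A ` K))" using K by (intro cond) auto
        \<comment> \<open>\<open>K\<close> misses \<open>i\<close>, so it is proper and not tight;
          the strict inequality pays for the loss of \<open>x\<close>.\<close>
        moreover have "K \<subset> I" using K i by blast
        then have "card (\<Union>(A ` K)) \<noteq> card K" using False K0 by blast
        moreover have eq: "\<Union>((\<lambda>j. A j - {x}) ` K) = \<Union>(A ` K) - {x}" by auto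
        moreover have "card (\<Union>(A ` K)) - 1 \<le> card (\<Union>(A ` K) - {x})"
          by (cases "x \<in> \<Union>(A ` K)") (auto simp: card_Diff_singleton)
        ultimately show ?thesis unfolding eq by linarith
      qed simp
      ultimately obtain g where g: "inj_on g (I - {i})" "\<forall>j\<in>I - {i}. g j \<in> A j - {x}"
        using less.hyps[of "I - {i}" "\<lambda>j. A j - {x}"] finI finA by auto
      have "inj_on (g(i := x)) I"
      proof (rule inj_onI)
        fix j l assume jl: "j \<in> I" "l \<in> I" "(g(i := x)) j = (g(i := x)) l"
        show "j = l"
        proof (cases "j = i \<or> l = i")
          case True
          then show ?thesis using jl g(2) by (metis DiffD2 DiffI fun_upd_apply singletonD singletonI)
        next
          case False
          then show ?thesis using jl inj_onD[OF g(1)] by simp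
        qed
      qed
      moreover have "\<forall>j\<in>I. (g(i := x)) j \<in> A j" using g x by auto
      ultimately show ?thesis by blast
    qed auto
  qed
qed

lemma simple_graph_finite_edges: "simple_graph G \<Longrightarrow> finite (edges G)"
  using finite_subset[of "edges G" "Pow (verts G)"] by (auto simp: simple_graph_def)

section \<open>Balanced orientations of multigraphs with even degrees\<close>

abbreviation undirect :: "'a \<times> 'a \<Rightarrow> 'a set" where
  "undirect \<equiv> \<lambda>(a, b). {a, b}"

text \<open>Two arcs through a vertex \<open>v\<close> are replaced by one arc bypassing \<open>v\<close>; this keeps all degrees
  even, and rerouting a balanced orientation through \<open>v\<close> keeps it balanced.\<close>

lemma balanced_orientation:
  fixes M :: "('a \<times> 'a) multiset"
  assumes "\<And>v. even (count (image_mset fst M + image_mset snd M) v)"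
  shows "\<exists>D. image_mset undirect D = image_mset undirect M \<and> image_mset fst D = image_mset snd D"
  using assms
proof (induction "size M" arbitrary: M rule: less_induct)
  case less
  show ?case
  proof (cases "M = {#}")
    case False
    then obtain a v N where M: "M = add_mset (a, v) N" by (metis multiset_cases surj_pair)
    show ?thesis
    proof (cases "a = v")
      \<comment> \<open>Bypassing can create loops. A loop counts twice at its vertex, so it can be
        set aside and put back.\<close>
      case True
      have "even (count (image_mset fst N + image_mset snd N) u)" for u
        using less.prems[of u] True by (auto simp: M split: if_splits)
      then obtain D where "image_mset undirect D = image_mset undirect N" "image_mset fst D = image_mset snd D"
        using less.hyps[of N] by (auto simp: M)
      then show ?thesis by (intro exI[of _ "add_mset (v, v) D"]) (simp add: M True)
    next
      case av: False
      have "odd (count (image_mset fst N + image_mset snd N) v)"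
        using less.prems[of v] av by (auto simp: M)
      then have "count (image_mset fst N + image_mset snd N) v \<noteq> 0" by (metis even_zero)
      then have "v \<in># image_mset fst N + image_mset snd N" by (meson count_eq_zero_iff)
      then have "\<exists>b. (v, b) \<in># N \<or> (b, v) \<in># N" by auto
      then obtain b where "(v, b) \<in># N \<or> (b, v) \<in># N" by blast
      then obtain d K where N: "N = add_mset d K" and d: "d = (v, b) \<or> d = (b, v)"
        by (metis insert_DiffM)
      have "even (count (image_mset fst (add_mset (a, b) K) + image_mset snd (add_mset (a, b) K)) u)" for u
        using less.prems[of u] d by (elim disjE) (simp_all add: M N split: if_splits)
      then obtain D where D: "image_mset undirect D = image_mset undirect (add_mset (a, b) K)"
        "image_mset fst D = image_mset snd D"
        using less.hyps[of "add_mset (a, b) K"] by (auto simp: M N)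
      \<comment> \<open>The new orientation may traverse the bypass either way; the two arcs through
        \<open>v\<close> that replace it follow the same direction, which balances
        \<open>v\<close>.\<close>
      have "{a, b} \<in># image_mset undirect D" by (simp add: D(1))
      then obtain x where x: "x \<in># D" "undirect x = {a, b}" by auto
      then obtain D' where D': "D = add_mset x D'" by (metis insert_DiffM)
      have und: "image_mset undirect M = add_mset {a, v} (add_mset {v, b} (image_mset undirect K))"
        using d by (elim disjE) (simp_all add: M N insert_commute)
      have undK: "image_mset undirect D' = image_mset undirect K" using D(1) x(2) by (simp add: D')
      from x(2) have "x = (a, b) \<or> x = (b, a)" by (cases x) (auto simp: doubleton_eq_iff)
      then show ?thesis
      proof
        assume "x = (a, b)"
        then show ?thesis using D(2) und undK
          by (intro exI[of _ "add_mset (a, v) (add_mset (v, b) D')"]) (simp add: D' add_mset_commute)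
      next
        assume "x = (b, a)"
        then show ?thesis using D(2) und undK
          by (intro exI[of _ "add_mset (b, v) (add_mset (v, a) D')"])
            (simp add: D' add_mset_commute insert_commute)
      qed
    qed
  qed auto
qed

section \<open>Splitting balanced arcs into permutations and these into cycles\<close>

text \<open>Fixed points contribute no edge, and a transposition contributes its edge twice, as does
  the list of its two points; hence the bound 2 on the length.\<close>

lemma permutation_cycles:
  assumes "finite V" "\<sigma> permutes V"
  shows "\<exists>F. distinct (concat F) \<and> set (concat F) \<subseteq> V \<and> (\<forall>c\<in>set F. 2 \<le> length c) \<and>
     (\<Sum>c\<leftarrow>F. cycle_mset c) = image_mset (\<lambda>v. {v, \<sigma> v}) (mset_set {v \<in> V. \<sigma> v \<noteq> v})"
  using cycle_decomposition[OF assms(2,1)]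
proof (induction)
  case empty
  show ?case by (rule exI[of _ "[]"]) simp
next
  case (comp I p cs)
  have p: "p permutes I" using comp.hyps(1)
  proof (induction)
    case (comp I p cs)
    then show ?case
      using cycle_permutes[of cs] permutes_compose permutes_subset
      by (metis sup_ge1 sup_ge2)
  qed (simp add: id_def)
  have finI: "finite I" using comp.hyps(1) by (induction) auto
  let ?\<rho> = "cycle_of_list cs"
  let ?M = "\<lambda>\<sigma> V. image_mset (\<lambda>v. {v, \<sigma> v}) (mset_set {v \<in> V. \<sigma> v \<noteq> v})"
  \<comment> \<open>The supports \<open>I\<close> and \<open>set cs\<close> are disjoint, so on each
    of them the composition acts as one factor.\<close>
  have onI: "(?\<rho> \<circ> p) v = p v" if "v \<in> I" for v
    using that p comp.hyps(3) permutes_in_image[OF p] by (auto intro!: id_outside_supp)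
  have oncs: "(?\<rho> \<circ> p) v = ?\<rho> v" if "v \<in> set cs" for v
    using that p comp.hyps(3) by (auto simp: permutes_def)
  have "{v \<in> set cs \<union> I. (?\<rho> \<circ> p) v \<noteq> v} = {v \<in> set cs. ?\<rho> v \<noteq> v} \<union> {v \<in> I. p v \<noteq> v}"
    using onI oncs by (auto simp del: comp_apply)
  then have "mset_set {v \<in> set cs \<union> I. (?\<rho> \<circ> p) v \<noteq> v} =
      mset_set {v \<in> set cs. ?\<rho> v \<noteq> v} + mset_set {v \<in> I. p v \<noteq> v}"
    using finI comp.hyps(3) by (auto intro!: mset_set_Union)
  moreover have "image_mset (\<lambda>v. {v, (?\<rho> \<circ> p) v}) (mset_set {v \<in> set cs. ?\<rho> v \<noteq> v}) = ?M ?\<rho> (set cs)"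
    using oncs by (intro image_mset_cong) auto
  moreover have "image_mset (\<lambda>v. {v, (?\<rho> \<circ> p) v}) (mset_set {v \<in> I. p v \<noteq> v}) = ?M p I"
    using onI finI by (intro image_mset_cong) auto
  ultimately have sum: "?M (?\<rho> \<circ> p) (set cs \<union> I) = ?M ?\<rho> (set cs) + ?M p I" by simp
  obtain F where F: "distinct (concat F)" "set (concat F) \<subseteq> I" "\<forall>c\<in>set F. 2 \<le> length c"
    "(\<Sum>c\<leftarrow>F. cycle_mset c) = ?M p I" using comp.IH by blast
  show ?case
  proof (cases "2 \<le> length cs")
    case True
    \<comment> \<open>The cyclic permutation shifts its own list by one, so the pairs of a vertex
      and its image are the consecutive pairs of the closed walk.\<close>
    have rot: "map ?\<rho> cs = rotate1 cs" using cyclic_rotation[OF comp.hyps(2), of 1] by simp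
    obtain x y ys where cs: "cs = x # y # ys" using True by (auto simp: numeral_2_eq_2 Suc_le_length_iff)
    have walk: "path_mset (z # zs) = mset (map2 (\<lambda>a b. {a, b}) (z # zs) zs)" for z :: 'a and zs
      by (induction zs arbitrary: z) auto
    have "?\<rho> v \<noteq> v" if "v \<in> set cs" for v
    proof -
      from that obtain i where i: "i < length cs" "v = cs ! i" by (auto simp: in_set_conv_nth)
      have "?\<rho> v = rotate1 cs ! i" using i rot by (metis nth_map)
      also have "\<dots> = cs ! (Suc i mod length cs)" using i by (simp add: nth_rotate1)
      finally have "?\<rho> v = cs ! (Suc i mod length cs)" .
      moreover have "Suc i mod length cs < length cs" "Suc i mod length cs \<noteq> i"
        using i True by (auto simp: mod_Suc)
      ultimately show ?thesis
        using i comp.hyps(2) by (simp add: nth_eq_iff_index_eq)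
    qed
    then have "{v \<in> set cs. ?\<rho> v \<noteq> v} = set cs" by auto
    then have "?M ?\<rho> (set cs) = mset (map (\<lambda>v. {v, ?\<rho> v}) cs)"
      using comp.hyps(2) by (simp add: mset_set_set)
    also have "map (\<lambda>v. {v, ?\<rho> v}) cs = map2 (\<lambda>a b. {a, b}) cs (rotate1 cs)"
      by (simp add: map2_map_map flip: rot) (simp add: zip_map2 zip_same_conv_map)
    also have "\<dots> = map2 (\<lambda>a b. {a, b}) (cs @ [x]) (rotate1 cs)"
      using zip_append[of cs "rotate1 cs" "[x]" "[]"] by simp
    also have "mset \<dots> = cycle_mset cs"
      using walk[of x "rotate1 cs"] by (simp add: cs cycle_mset_Cons)
    finally show ?thesis
      using F True comp.hyps(2,3) sum by (intro exI[of _ "cs # F"]) auto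
  next
    case False
    then have "?\<rho> = id" by (cases cs rule: cycle_of_list.cases) auto
    then have "?M (?\<rho> \<circ> p) (set cs \<union> I) = ?M p I" using sum by simp
    then show ?thesis using F by (intro exI[of _ F]) auto
  qed
qed

text \<open>With \<open>fst\<close> or \<open>snd\<close> for \<open>f\<close> this turns a sum of
  outdegrees or indegrees into a number of arcs.\<close>

lemma size_filter_fst:
  assumes "finite J"
  shows "(\<Sum>v\<in>J. count (image_mset f D) v) = size {#d \<in># D. f d \<in> J#}"
proof (induction D)
  case (add d D)
  have "(\<Sum>v\<in>J. count (image_mset f (add_mset d D)) v) =
      (\<Sum>v\<in>J. count (image_mset f D) v + of_bool (f d = v))"
    by (intro sum.cong) auto
  then show ?case using add assms by (simp add: sum.distrib of_bool_def)
qed simp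

text \<open>A vertex of outdegree below \<open>k\<close> may stay fixed, as if it carried
  \<open>k - out v\<close> loops. These loops make the digraph \<open>k\<close>-regular, and Hall's
  condition is the usual count: all arcs and loops that leave \<open>J\<close> enter
  \<open>N\<close>.\<close>

lemma spanning_permutation:
  fixes D :: "('a \<times> 'a) multiset"
  assumes V: "finite V" "\<And>d. d \<in># D \<Longrightarrow> fst d \<in> V"
    and bal: "image_mset fst D = image_mset snd D"
    and le: "\<And>v. count (image_mset fst D) v \<le> k" and k: "0 < k"
  shows "\<exists>\<sigma>. \<sigma> permutes V \<and>
     (\<forall>v\<in>V. (v, \<sigma> v) \<in># D \<or> \<sigma> v = v \<and> count (image_mset fst D) v < k)"
proof -
  define out where "out = count (image_mset fst D)"
  define A where "A v = {w. (v, w) \<in># D} \<union> (if out v < k then {v} else {})" for v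
  have snd: "snd d \<in> V" if "d \<in># D" for d
  proof -
    have "snd d \<in># image_mset fst D" using that unfolding bal by simp
    then show ?thesis using V(2) by auto
  qed
  have AV: "A v \<subseteq> V" if "v \<in> V" for v using that snd by (auto simp: A_def)
  have "card J \<le> card (\<Union>(A ` J))" if J: "J \<subseteq> V" for J
  proof -
    define N where "N = \<Union>(A ` J)"
    have NV: "N \<subseteq> V" using AV J by (auto simp: N_def)
    have fin: "finite J" "finite N" using J NV V(1) finite_subset by blast+
    have "size {#d \<in># D. fst d \<in> J#} \<le> size {#d \<in># D. snd d \<in> N#}"
      by (intro size_mset_mono filter_mset_mono_strong) (auto simp: N_def A_def intro: bexI[of _ "fst _"])
    then have "(\<Sum>v\<in>J. out v) \<le> (\<Sum>w\<in>N. out w)"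
      using size_filter_fst[OF fin(1), of fst D] size_filter_fst[OF fin(2), of snd D]
      by (simp add: out_def bal)
    \<comment> \<open>The added loops are counted separately: a vertex of \<open>J\<close> that has
      any belongs to \<open>N\<close>.\<close>
    moreover have "(\<Sum>v\<in>J. k - out v) \<le> (\<Sum>w\<in>N. k - out w)"
    proof -
      have "(\<Sum>v\<in>J. k - out v) = (\<Sum>v\<in>{v \<in> J. out v < k}. k - out v)"
        using fin by (intro sum.mono_neutral_right) auto
      also have "\<dots> \<le> (\<Sum>w\<in>N. k - out w)"
        using fin by (intro sum_mono2) (auto simp: N_def A_def)
      finally show ?thesis .
    qed
    ultimately have "(\<Sum>v\<in>J. out v + (k - out v)) \<le> (\<Sum>w\<in>N. out w + (k - out w))"
      by (simp add: sum.distrib)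
    then have "k * card J \<le> k * card N" using le by (simp add: out_def mult.commute)
    then show ?thesis using k by (simp add: N_def)
  qed
  then obtain f where f: "inj_on f V" "\<forall>v\<in>V. f v \<in> A v"
    using hall[of V A] V(1) AV finite_subset by metis
  define \<sigma> where "\<sigma> v = (if v \<in> V then f v else v)" for v
  have "f ` V \<subseteq> V" using f(2) AV by auto
  then have "bij_betw f V V" using f(1) V(1) by (simp add: bij_betw_def endo_inj_surj)
  then have "bij_betw \<sigma> V V" by (rule bij_betw_cong[THEN iffD1, rotated]) (simp add: \<sigma>_def)
  then have "\<sigma> permutes V" by (rule bij_imp_permutes) (simp add: \<sigma>_def)
  moreover have "\<forall>v\<in>V. (v, \<sigma> v) \<in># D \<or> \<sigma> v = v \<and> out v < k"
    using f(2) by (auto simp: \<sigma>_def A_def split: if_splits)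
  ultimately show ?thesis unfolding out_def by blast
qed

text \<open>Removing the arcs of a permutation lowers every outdegree that equals the bound, since
  such a vertex cannot be fixed. The removed arcs enter and leave the same vertices, so the rest
  stays balanced.\<close>

lemma balanced_cycle_systems:
  fixes D :: "('a \<times> 'a) multiset"
  assumes "finite V" "\<And>d. d \<in># D \<Longrightarrow> fst d \<in> V \<and> fst d \<noteq> snd d"
    "image_mset fst D = image_mset snd D" "\<And>v. count (image_mset fst D) v \<le> k"
  shows "\<exists>Fs. length Fs = k \<and>
     (\<forall>F\<in>set Fs. distinct (concat F) \<and> set (concat F) \<subseteq> V \<and> (\<forall>c\<in>set F. 2 \<le> length c)) \<and>
     (\<Sum>F\<leftarrow>Fs. \<Sum>c\<leftarrow>F. cycle_mset c) = image_mset undirect D"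
  using assms
proof (induction k arbitrary: D)
  case 0
  have "image_mset fst D = {#}" using 0(4) by (intro multiset_eqI) simp
  then show ?case by simp
next
  case (Suc k)
  obtain \<sigma> where \<sigma>: "\<sigma> permutes V"
    "\<And>v. v \<in> V \<Longrightarrow> (v, \<sigma> v) \<in># D \<or> \<sigma> v = v \<and> count (image_mset fst D) v < Suc k"
    using spanning_permutation[of V D "Suc k"] Suc.prems by (metis zero_less_Suc)
  define S where "S = {v \<in> V. \<sigma> v \<noteq> v}"
  have finS: "finite S" using Suc.prems(1) by (simp add: S_def)
  define P where "P = image_mset (\<lambda>v. (v, \<sigma> v)) (mset_set S)"
  \<comment> \<open>The arcs of \<open>P\<close> are distinct, so it suffices that each of them
    occurs in \<open>D\<close>.\<close>
  have "P = mset_set ((\<lambda>v. (v, \<sigma> v)) ` S)"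
    unfolding P_def by (intro image_mset_mset_set inj_onI) simp
  also have "\<dots> \<subseteq># D"
  proof -
    have "(\<lambda>v. (v, \<sigma> v)) ` S \<subseteq> set_mset D" using \<sigma>(2) by (auto simp: S_def)
    then show ?thesis
      by (meson finite_set_mset mset_set_set_mset_msubset subset_imp_msubset_mset_set subset_mset.order_trans)
  qed
  finally have sub: "P \<subseteq># D" .
  define D' where "D' = D - P"
  have D: "D = P + D'" using sub by (simp add: D'_def)
  have "\<sigma> ` S = S"
  proof -
    have V: "\<sigma> ` V = V" and inj: "inj \<sigma>" using \<sigma>(1) permutes_image permutes_inj by auto
    have "\<sigma> v \<in> S \<longleftrightarrow> v \<in> S" for v
      using permutes_in_image[OF \<sigma>(1)] injD[OF inj] by (auto simp: S_def)
    moreover have "S \<subseteq> \<sigma> ` V" unfolding V by (auto simp: S_def)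
    ultimately show ?thesis by blast
  qed
  moreover have "inj_on \<sigma> S" using \<sigma>(1) permutes_inj inj_on_subset by blast
  ultimately have Psnd: "image_mset snd P = mset_set S"
    by (simp add: P_def multiset.map_comp comp_def image_mset_mset_set)
  have Pfst: "image_mset fst P = mset_set S"
    by (simp add: P_def multiset.map_comp comp_def)
  have "count (image_mset fst D') v \<le> k" for v
  proof (cases "v \<in> S")
    case True
    then show ?thesis using Suc.prems(4)[of v] Pfst finS by (simp add: D)
  next
    case False
    show ?thesis
    proof (cases "v \<in> V")
      case True
      then have "\<sigma> v = v" using False by (simp add: S_def)
      \<comment> \<open>\<open>D\<close> has no loops, so a vertex fixed by \<open>\<sigma>\<close>
        has outdegree below the bound.\<close>
      moreover have "(v, v) \<notin># D" using Suc.prems(2) by force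
      ultimately have "count (image_mset fst D) v < Suc k" using \<sigma>(2)[OF True] by metis
      then show ?thesis by (simp add: D)
    next
      case False
      then have "v \<notin># image_mset fst D'" using Suc.prems(2) by (auto simp: D)
      then show ?thesis unfolding not_in_iff by linarith
    qed
  qed
  then obtain Fs where Fs: "length Fs = k"
     "\<forall>F\<in>set Fs. distinct (concat F) \<and> set (concat F) \<subseteq> V \<and> (\<forall>c\<in>set F. 2 \<le> length c)"
     "(\<Sum>F\<leftarrow>Fs. \<Sum>c\<leftarrow>F. cycle_mset c) = image_mset undirect D'"
    using Suc.IH[of D'] Suc.prems Psnd Pfst by (auto simp: D)
  obtain F where F: "distinct (concat F)" "set (concat F) \<subseteq> V" "\<forall>c\<in>set F. 2 \<le> length c"
     "(\<Sum>c\<leftarrow>F. cycle_mset c) = image_mset (\<lambda>v. {v, \<sigma> v}) (mset_set S)"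
    using permutation_cycles[OF Suc.prems(1) \<sigma>(1)] unfolding S_def by blast
  have "image_mset undirect P = image_mset (\<lambda>v. {v, \<sigma> v}) (mset_set S)"
    by (simp add: P_def multiset.map_comp comp_def)
  then show ?case
    using F Fs by (intro exI[of _ "F # Fs"]) (simp add: D)
qed

lemma size_filter_undirect:
  assumes "\<And>d. d \<in># D \<Longrightarrow> fst d \<noteq> snd d"
  shows "count (image_mset fst D + image_mset snd D) v = size {#e \<in># image_mset undirect D. v \<in> e#}"
  using assms
proof (induction D)
  case (add d D)
  have "fst d \<noteq> snd d" using add.prems by simp
  moreover have "count (image_mset fst D + image_mset snd D) v = size {#e \<in># image_mset undirect D. v \<in> e#}"
    using add.prems by (intro add.IH) simp
  ultimately show ?case by (cases d) auto
qed simp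

text \<open>A balanced orientation turns half of each degree into outdegree, which gives the number
  of systems. A two-vertex cycle would use an edge twice, which is impossible as the edges form a
  set.\<close>

lemma eulerian_cycle_systems:
  assumes "simple_graph G" "eulerian G"
  shows "\<exists>Fs. length Fs = max_degree G div 2 \<and>
     (\<forall>F\<in>set Fs. distinct (concat F) \<and> (\<forall>c\<in>set F. is_cycle (verts G) c)) \<and>
     (\<Sum>F\<leftarrow>Fs. \<Sum>c\<leftarrow>F. cycle_mset c) = mset_set (edges G)"
proof -
  define V where "V = verts G"
  define E where "E = edges G"
  have finV: "finite V" and edge: "\<And>e. e \<in> E \<Longrightarrow> e \<subseteq> V \<and> card e = 2"
    using assms(1) by (auto simp: simple_graph_def V_def E_def)
  have finE: "finite E" unfolding E_def by (rule simple_graph_finite_edges[OF assms(1)])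
  have "\<forall>e\<in>E. \<exists>d. undirect d = e" using edge by (force simp: card_2_iff)
  then obtain h where h: "\<And>e. e \<in> E \<Longrightarrow> undirect (h e) = e" by metis
  have undirE: "fst d \<noteq> snd d \<and> fst d \<in> V \<and> snd d \<in> V" if "undirect d \<in> E" for d
    using edge[OF that] by (cases d) auto
  define M where "M = image_mset h (mset_set E)"
  have M: "image_mset undirect M = mset_set E"
    using h finE image_mset_cong[of "mset_set E" "undirect \<circ> h" id]
    by (simp add: M_def multiset.map_comp comp_def)
  have arcE: "undirect d \<in> E" if "image_mset undirect D = mset_set E" "d \<in># D" for d D
  proof -
    have "undirect d \<in># image_mset undirect D" using that(2) by simp
    then show ?thesis unfolding that(1) using finE by simp
  qed
  have deg: "count (image_mset fst D + image_mset snd D) v = degree G v"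
    if "image_mset undirect D = mset_set E" for D v
  proof -
    have "count (image_mset fst D + image_mset snd D) v = size {#e \<in># mset_set E. v \<in> e#}"
      using size_filter_undirect[of D v] undirE arcE[OF that] that by metis
    then show ?thesis using finE by (simp add: degree_def E_def)
  qed
  have deg0: "degree G v = 0" if "v \<notin> V" for v
  proof -
    have "{e \<in> edges G. v \<in> e} = {}" using that edge by (auto simp: E_def)
    then show ?thesis unfolding degree_def by (metis card.empty)
  qed
  have "even (degree G v)" for v
    using assms(2) deg0[of v] by (cases "v \<in> V") (auto simp: eulerian_def V_def)
  then have "even (count (image_mset fst M + image_mset snd M) v)" for v
    unfolding deg[OF M] .
  from balanced_orientation[OF this]
  obtain D where D: "image_mset undirect D = mset_set E" "image_mset fst D = image_mset snd D"
    unfolding M by blast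
  have DE: "undirect d \<in> E" if "d \<in># D" for d
    using arcE[OF D(1) that] .
  have "count (image_mset fst D) v \<le> max_degree G div 2" for v
  proof -
    have "2 * count (image_mset fst D) v = degree G v" using deg[OF D(1), of v] D(2) by simp
    moreover have "degree G v \<le> max_degree G"
      using deg0[of v] finV by (cases "v \<in> V") (auto simp: max_degree_def V_def)
    ultimately show ?thesis by linarith
  qed
  then obtain Fs where Fs: "length Fs = max_degree G div 2"
     "\<forall>F\<in>set Fs. distinct (concat F) \<and> set (concat F) \<subseteq> V \<and> (\<forall>c\<in>set F. 2 \<le> length c)"
     "(\<Sum>F\<leftarrow>Fs. \<Sum>c\<leftarrow>F. cycle_mset c) = mset_set E"
    using balanced_cycle_systems[of V D "max_degree G div 2"] D finV DE undirE by auto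
  have "is_cycle V c" if c: "c \<in> set F" "F \<in> set Fs" for c F
  proof -
    have len: "2 \<le> length c" "distinct c" "set c \<subseteq> V"
      using c Fs(2) by (auto simp: distinct_concat_iff)
    have "cycle_mset c \<subseteq># (\<Sum>c\<leftarrow>F. cycle_mset c)"
      using c(1) by (auto simp: in_set_conv_decomp)
    also have "\<dots> \<subseteq># mset_set E"
      unfolding Fs(3)[symmetric] using c(2) by (auto simp: in_set_conv_decomp)
    finally have sub: "cycle_mset c \<subseteq># mset_set E" .
    have "length c \<noteq> 2"
    proof
      assume "length c = 2"
      then obtain a b where "c = [a, b]" by (auto simp: numeral_2_eq_2 length_Suc_conv)
      then have "count (cycle_mset c) {a, b} = 2" by (simp add: cycle_mset_def insert_commute)
      moreover have "count (mset_set E) {a, b} \<le> 1" by (simp add: count_mset_set')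
      ultimately show False using mset_subset_eq_count[OF sub, of "{a, b}"] by simp
    qed
    then show ?thesis using len by (simp add: is_cycle_def)
  qed
  then show ?thesis using Fs by (auto simp: V_def E_def intro!: exI[of _ Fs])
qed

section \<open>Covering systems of disjoint cycles\<close>

text \<open>The closing edge of a cycle, read as a two-vertex path from the first to the last
  vertex. It shares its ends with the cycle opened there, so one can replace the other inside a
  closed walk.\<close>

abbreviation ends :: "'a list \<Rightarrow> 'a list" where
  "ends c \<equiv> [hd c, last c]"

lemma set_ends: "c \<noteq> [] \<Longrightarrow> set (ends c) \<subseteq> set c"
  by simp

lemma set_concat_map_ends:
  assumes "\<forall>c\<in>set F. c \<noteq> []"
  shows "set (concat (map ends F)) \<subseteq> set (concat F)"
proof -
  have "set (concat (map ends F)) = (\<Union>c\<in>set F. set (ends c))" by simp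
  also have "\<dots> \<subseteq> (\<Union>c\<in>set F. set c)" using assms set_ends by blast
  finally show ?thesis by simp
qed

lemma concat_map_ends:
  assumes "distinct (concat F)" "\<forall>c\<in>set F. 2 \<le> length c"
  shows "distinct (concat (map ends F))" "set (concat (map ends F)) \<subseteq> set (concat F)"
proof -
  have ne: "c \<noteq> []" if "2 \<le> length c" for c :: "'a list"
    using that by (cases c) auto
  show "set (concat (map ends F)) \<subseteq> set (concat F)"
    using assms(2) ne by (intro set_concat_map_ends) blast
  show "distinct (concat (map ends F))"
    using assms
  proof (induction F)
    case (Cons c F)
    obtain a b d where c: "c = a # b # d" using Cons.prems(2) by (auto simp: numeral_2_eq_2 Suc_le_length_iff)
    have "hd c \<noteq> last c" using Cons.prems(1) by (auto simp: c)
    moreover have "set (ends c) \<subseteq> set c" by (rule set_ends) (simp add: c)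
    moreover have "set (concat (map ends F)) \<subseteq> set (concat F)"
      using Cons.prems(2) ne by (intro set_concat_map_ends) simp
    moreover have "set c \<inter> set (concat F) = {}" using Cons.prems(1) by simp
    ultimately have "distinct (ends c)" "set (ends c) \<inter> set (concat (map ends F)) = {}"
      by (simp, blast)
    then show ?case using Cons by (simp only: list.map concat.simps distinct_append) simp
  qed simp
qed

lemma cycle_mset_path_ends: "cycle_mset c = path_mset c + path_mset (ends c)"
  by (simp add: cycle_mset_def insert_commute)

text \<open>This keeps the cycles of one system and the end vertices of the other together free of
  repetitions.\<close>

definition separated :: "'a list list \<Rightarrow> 'a list list \<Rightarrow> bool" where
  "separated F F' \<longleftrightarrow> (\<forall>c\<in>set F. set (ends c) \<inter> set (concat F') = {}) \<and>
     (\<forall>c\<in>set F'. set (ends c) \<inter> set (concat F) = {})"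

definition cycle_system :: "'a set \<Rightarrow> 'a list list \<Rightarrow> bool" where
  "cycle_system V F \<longleftrightarrow> distinct (concat F) \<and> (\<forall>c\<in>set F. is_cycle V c)"

lemma cycle_system_subset: "cycle_system V F \<Longrightarrow> set (concat F) \<subseteq> V"
  by (auto simp: cycle_system_def is_cycle_def)

text \<open>Two closed walks visit all cycles in the same order. One follows the cycles of
  \<open>F\<close> and only the closing edges of \<open>F'\<close>, the other the reverse; all other
  edges cancel. An empty \<open>F'\<close> gives two cycles for a single system.\<close>

lemma covered_two_systems:
  assumes F: "cycle_system V F" and F': "cycle_system V F'" and sep: "separated F F'"
  shows "covered V 2 ((\<Sum>c\<leftarrow>F. cycle_mset c) + (\<Sum>c\<leftarrow>F'. cycle_mset c))"
proof -
  have cyc: "is_cycle V c" if "c \<in> set (F @ F')" for c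
    using that F F' by (auto simp: cycle_system_def)
  \<comment> \<open>One cycle in all is treated apart: its closing edge alone would be a walk on two
    vertices.\<close>
  consider "F @ F' = []" | c where "F @ F' = [c]" | "2 \<le> length (F @ F')"
    by (cases "F @ F'" rule: list.exhaust; cases "tl (F @ F')") auto
  then show ?thesis
  proof cases
    case 1
    then show ?thesis by simp
  next
    case (2 c)
    then have "(\<Sum>c\<leftarrow>F. cycle_mset c) + (\<Sum>c\<leftarrow>F'. cycle_mset c) = cycle_mset c"
      using sum_list_append[of "map cycle_mset F" "map cycle_mset F'"]
      by (simp flip: map_append)
    moreover have "covered V 1 (cycle_mset c)" using 2 cyc by (intro covered_cycle) simp
    ultimately show ?thesis using covered_mono[of V 1 _ 2 V] by simp
  next
    case 3
    \<comment> \<open>The tag records the system, so that one index list drives both walks.\<close>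
    define xs where "xs = map (Pair True) F @ map (Pair False) F'"
    define f g where "f = (\<lambda>(b, c :: 'a list). if b then c else ends c)"
      and "g = (\<lambda>(b, c :: 'a list). if b then ends c else c)"
    have len2: "2 \<le> length c" if "c \<in> set (F @ F')" for c
      using cyc[OF that] by (simp add: is_cycle_def)
    have ne: "c \<noteq> []" if "c \<in> set (F @ F')" for c using len2[OF that] by auto
    have A: "concat (map f xs) = concat F @ concat (map ends F')"
      and B: "concat (map g xs) = concat (map ends F) @ concat F'"
      by (simp_all add: xs_def f_def g_def comp_def)
    have "xs \<noteq> []" using 3 by (auto simp: xs_def)
    moreover have "\<forall>i\<in>set xs. f i \<noteq> [] \<and> g i \<noteq> [] \<and> hd (f i) = hd (g i) \<and> last (f i) = last (g i)"
      using ne by (auto simp: xs_def f_def g_def)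
    ultimately obtain X where X: "cycle_mset (concat (map f xs)) + cycle_mset (concat (map g xs)) =
       (\<Sum>i\<leftarrow>xs. path_mset (f i) + path_mset (g i)) + X + X"
      using cycle_mset_concat_pair[of xs f g] by blast
    also have "(\<Sum>i\<leftarrow>xs. path_mset (f i) + path_mset (g i)) =
        (\<Sum>c\<leftarrow>F. cycle_mset c) + (\<Sum>c\<leftarrow>F'. cycle_mset c)"
      by (simp add: xs_def f_def g_def comp_def cycle_mset_path_ends add.commute)
    finally have sum: "cycle_mset (concat (map f xs)) + cycle_mset (concat (map g xs)) =
        (\<Sum>c\<leftarrow>F. cycle_mset c) + (\<Sum>c\<leftarrow>F'. cycle_mset c) + X + X" .
    have dist: "distinct (concat (map f xs))" "distinct (concat (map g xs))"
      using F F' len2 sep concat_map_ends[of F] concat_map_ends[of F']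
      unfolding A B by (auto simp: cycle_system_def separated_def)
    have len: "4 \<le> length (concat (map h xs))" if "\<forall>i\<in>set xs. 2 \<le> length (h i)" for h :: "_ \<Rightarrow> 'a list"
    proof -
      have "2 * length xs \<le> length (concat (map h xs))"
        using that by (induction xs) auto
      then show ?thesis using 3 by (simp add: xs_def)
    qed
    have "set (concat (map f xs)) \<subseteq> V" "set (concat (map g xs)) \<subseteq> V"
      using cycle_system_subset[OF F] cycle_system_subset[OF F'] len2
        concat_map_ends(2)[of F] concat_map_ends(2)[of F'] F F'
      unfolding A B cycle_system_def by auto
    moreover have "\<forall>i\<in>set xs. 2 \<le> length (f i)" "\<forall>i\<in>set xs. 2 \<le> length (g i)"
      using len2 by (auto simp: xs_def f_def g_def)
    ultimately have "is_cycle V (concat (map f xs))" "is_cycle V (concat (map g xs))"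
      using dist len[of f] len[of g] by (simp_all add: is_cycle_def)
    then have "covered V (1 + 1) (cycle_mset (concat (map f xs)) + cycle_mset (concat (map g xs)))"
      by (intro covered_add covered_cycle)
    then show ?thesis
      unfolding sum covered_cong[OF odd_part_double] by (simp add: numeral_2_eq_2)
  qed
qed

lemma c2_le_max_degree:
  assumes "simple_graph G" "eulerian G"
  shows "c2 G \<le> enat (max_degree G)"
proof -
  obtain Fs where Fs: "length Fs = max_degree G div 2"
     "\<And>F. F \<in> set Fs \<Longrightarrow> cycle_system (verts G) F"
     "(\<Sum>F\<leftarrow>Fs. \<Sum>c\<leftarrow>F. cycle_mset c) = mset_set (edges G)"
    using eulerian_cycle_systems[OF assms] unfolding cycle_system_def by blast
  have "finite (edges G)" by (rule simple_graph_finite_edges[OF assms(1)])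
  have "covered V (2 * length Fs) (\<Sum>F\<leftarrow>Fs. \<Sum>c\<leftarrow>F. cycle_mset c)"
    if "\<forall>F\<in>set Fs. cycle_system V F" for Fs and V :: "'a set"
    using that
  proof (induction Fs)
    case (Cons F Fs)
    \<comment> \<open>The empty system is separated from \<open>F\<close>, so each system is covered
      on its own.\<close>
    have "covered V 2 (\<Sum>c\<leftarrow>F. cycle_mset c)"
      using covered_two_systems[of V F "[]"] Cons.prems by (simp add: cycle_system_def separated_def)
    then show ?case using covered_add[of V 2 _ "2 * length Fs"] Cons by simp
  qed simp
  then have "covered (verts G) (2 * length Fs) (mset_set (edges G))" using Fs(2,3) by metis
  then have "c2 G \<le> enat (2 * length Fs)"
    by (rule c2_le_covered) (rule odd_part_mset_set[OF \<open>finite (edges G)\<close>])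
  also have "2 * length Fs \<le> max_degree G" using Fs(1) by simp
  finally show ?thesis by simp
qed

text \<open>A system with at least two cycles is one cycle up to the cycle through the ends of all its
  members, and that cycle can be passed on to the next system.\<close>

lemma covered_systems:
  assumes "2 \<le> length Fs" "\<forall>F\<in>set Fs. cycle_system V F" "sorted_wrt separated Fs"
  shows "covered V (length Fs) (\<Sum>F\<leftarrow>Fs. \<Sum>c\<leftarrow>F. cycle_mset c)"
  using assms
proof (induction "length Fs" arbitrary: Fs)
  case (Suc n)
  from Suc.prems(1) obtain F F' Gs where Fs: "Fs = F # F' # Gs"
    by (auto simp: numeral_2_eq_2 Suc_le_length_iff)
  have F: "cycle_system V F" and F': "cycle_system V F'" and sep: "separated F F'"
    using Suc.prems by (auto simp: Fs)
  show ?case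
  proof (cases "Gs = []")
    case True
    then show ?thesis using covered_two_systems[OF F F' sep] by (simp add: Fs numeral_2_eq_2)
  next
    case False
    have IH: "covered V (length (H # Gs)) (\<Sum>F\<leftarrow>H # Gs. \<Sum>c\<leftarrow>F. cycle_mset c)"
      if "cycle_system V H" "\<forall>G\<in>set Gs. separated H G" for H
      using that Suc.prems Suc.hyps(2) False by (intro Suc.hyps(1)) (auto simp: Fs Suc_le_eq)
    show ?thesis
    proof (cases "2 \<le> length F")
      \<comment> \<open>A system with at most one cycle is covered directly and passes nothing on;
        at least two systems remain.\<close>
      case short: False
      then have "covered V 1 (\<Sum>c\<leftarrow>F. cycle_mset c)"
        using covered_cycle[of V "hd F"] F by (cases F; cases "tl F") (auto simp: cycle_system_def)
      moreover have "covered V (length (F' # Gs)) (\<Sum>F\<leftarrow>F' # Gs. \<Sum>c\<leftarrow>F. cycle_mset c)"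
        using F' Suc.prems by (intro IH) (auto simp: Fs)
      ultimately show ?thesis using covered_add[of V 1 _ "length (F' # Gs)"] by (simp add: Fs)
    next
      case long: True
      have len3: "3 \<le> length c" "c \<noteq> []" if "c \<in> set F" for c
        using that F by (auto simp: cycle_system_def is_cycle_def)
      then have len2: "\<forall>c\<in>set F. 2 \<le> length c" by force
      \<comment> \<open>\<open>Z\<close> visits the ends in the same order as
        \<open>concat F\<close>, so the connecting edges cancel and the cycles of \<open>F\<close>
        remain.\<close>
      define Z where "Z = concat (map ends F)"
      from long obtain c1 c2 D where D: "F = c1 # c2 # D"
        by (auto simp: numeral_2_eq_2 Suc_le_length_iff)
      obtain X where X: "cycle_mset (concat F) + cycle_mset Z = (\<Sum>c\<leftarrow>F. cycle_mset c) + X + X"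
        using cycle_mset_concat_pair[of F id ends] len3(2)
        by (simp add: Z_def cycle_mset_path_ends D) blast
      have distF: "distinct (concat F)" using F by (simp add: cycle_system_def)
      have "is_cycle V (concat F)"
        using cycle_system_subset[OF F] distF len3(1)[of c1] by (auto simp: is_cycle_def D)
      then have 1: "covered V 1 (cycle_mset (concat F))" by (rule covered_cycle)
      have Zsub: "set Z \<subseteq> set (concat F)" unfolding Z_def by (rule concat_map_ends(2)[OF distF len2])
      have "3 \<le> length Z" by (simp add: Z_def D)
      moreover have "distinct Z" unfolding Z_def by (rule concat_map_ends(1)[OF distF len2])
      ultimately have "is_cycle V Z"
        using cycle_system_subset[OF F] Zsub by (simp only: is_cycle_def) blast
      have setZ: "set Z = (\<Union>c\<in>set F. set (ends c))" by (auto simp: Z_def)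
      have Zapart: "set Z \<inter> set (concat G) = {}" if "separated F G" for G
        using that unfolding setZ separated_def by blast
      have Zends: "set (ends Z) \<subseteq> set Z" by (rule set_ends) (simp add: Z_def D)
      \<comment> \<open>\<open>Z\<close> becomes a further cycle of the next system, which avoids
        its vertices because they are ends of \<open>F\<close>.\<close>
      have "cycle_system V (Z # F')"
        using \<open>is_cycle V Z\<close> F' Zapart[OF sep] by (auto simp: cycle_system_def is_cycle_def)
      \<comment> \<open>The later systems avoid all of \<open>Z\<close>, and their ends avoid
        \<open>concat F\<close>, hence also \<open>Z\<close>.\<close>
      moreover have "separated (Z # F') G" if "G \<in> set Gs" for G
      proof -
        have FG: "separated F G" "separated F' G" using Suc.prems(3) that by (simp_all add: Fs)
        show ?thesis
          unfolding separated_def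
        proof (intro conjI ballI)
          fix c assume "c \<in> set (Z # F')"
          then consider "c = Z" | "c \<in> set F'" by auto
          then show "set (ends c) \<inter> set (concat G) = {}"
          proof cases
            case 1
            then show ?thesis using Zapart[OF FG(1)] Zends by blast
          next
            case 2
            then show ?thesis using FG(2) unfolding separated_def by blast
          qed
        next
          fix c assume c: "c \<in> set G"
          have "set (ends c) \<inter> set (concat F) = {}" "set (ends c) \<inter> set (concat F') = {}"
            using FG c unfolding separated_def by blast+
          moreover have "set (concat (Z # F')) \<subseteq> set (concat F) \<union> set (concat F')" using Zsub by auto
          ultimately show "set (ends c) \<inter> set (concat (Z # F')) = {}" by blast
        qed
      qed
      ultimately have "covered V (length ((Z # F') # Gs)) (\<Sum>F\<leftarrow>(Z # F') # Gs. \<Sum>c\<leftarrow>F. cycle_mset c)"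
        by (intro IH) auto
      from covered_add[OF 1 this] have "covered V (length Fs)
          (cycle_mset (concat F) + (\<Sum>F\<leftarrow>(Z # F') # Gs. \<Sum>c\<leftarrow>F. cycle_mset c))"
        by (simp add: Fs)
      also have "cycle_mset (concat F) + (\<Sum>F\<leftarrow>(Z # F') # Gs. \<Sum>c\<leftarrow>F. cycle_mset c) =
          (cycle_mset (concat F) + cycle_mset Z) + ((\<Sum>c\<leftarrow>F'. cycle_mset c) + (\<Sum>F\<leftarrow>Gs. \<Sum>c\<leftarrow>F. cycle_mset c))"
        by simp
      also have "\<dots> = (\<Sum>F\<leftarrow>Fs. \<Sum>c\<leftarrow>F. cycle_mset c) + X + X"
        unfolding X by (simp add: Fs)
      finally show ?thesis unfolding covered_cong[OF odd_part_double] .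
    qed
  qed
qed simp

section \<open>Subdivisions\<close>

lemma subdivision_step_degree:
  assumes H: "simple_graph H" and uv: "{u, v} \<in> edges H" and w: "w \<notin> verts H"
    and H': "H' = Graph (insert w (verts H)) (edges H - {{u, v}} \<union> {{u, w}, {w, v}})"
  shows "simple_graph H'" "x \<in> verts H \<Longrightarrow> degree H' x = degree H x"
proof -
  have uv': "u \<noteq> v" "u \<in> verts H" "v \<in> verts H"
    using H uv by (auto simp: simple_graph_def)
  with w have "u \<noteq> w" "v \<noteq> w" by auto
  then show "simple_graph H'"
    using H uv' by (auto simp: simple_graph_def H')
  assume x: "x \<in> verts H"
  \<comment> \<open>The edges at \<open>x\<close> that the step leaves alone. At an end of the
    subdivided edge, one edge is exchanged for another.\<close>
  define R where "R = {e \<in> edges H - {{u, v}}. x \<in> e}"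
  have finR: "finite R" using simple_graph_finite_edges[OF H] by (simp add: R_def)
  have wR: "{u, w} \<notin> R" "{w, v} \<notin> R"
    using H w by (auto simp: R_def simple_graph_def)
  have deg: "degree H x = card (R \<union> (if x = u \<or> x = v then {{u, v}} else {}))"
    unfolding degree_def using uv by (intro arg_cong[of _ _ card]) (auto simp: R_def)
  have deg': "degree H' x = card (R \<union> (if x = u then {{u, w}} else if x = v then {{w, v}} else {}))"
    unfolding degree_def using x w uv' by (intro arg_cong[of _ _ card]) (auto simp: R_def H')
  have "{u, v} \<notin> R" by (simp add: R_def)
  then show "degree H' x = degree H x"
    unfolding deg deg' using finR wR uv'(1) by auto
qed

lemma subdivision_degree:
  assumes "subdivision G H" "simple_graph G"
  shows "simple_graph H \<and> verts G \<subseteq> verts H \<and> (\<forall>x\<in>verts G. degree H x = degree G x)"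
  using assms
proof (induction)
  case (subdivision_step H u v w)
  then have H: "simple_graph H" "verts G \<subseteq> verts H" "\<forall>x\<in>verts G. degree H x = degree G x" by auto
  then show ?case
    using subdivision_step_degree[OF H(1) subdivision_step.hyps(2,3) refl] by auto
qed simp

section \<open>The lower bound from vertex degrees\<close>

text \<open>The ends have the sharper bound because the closing edge of a cycle adds one more edge
  there.\<close>

lemma path_mset_degree:
  assumes "distinct p" "p \<noteq> []"
  shows "size {#e \<in># path_mset p. v \<in> e#} \<le> (if v = hd p \<or> v = last p then 1 else 2)"
  using assms
proof (induction p rule: path_mset.induct)
  case (3 x y zs)
  let ?d = "\<lambda>p. size {#e \<in># path_mset p. v \<in> e#}"
  have IH: "?d (y # zs) \<le> (if v = y \<or> v = last (y # zs) then 1 else 2)"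
    using 3 by simp
  consider "v = x" | "v = y" "zs = []" | "v = y" "v \<noteq> x" "v \<noteq> last (y # zs)" | "v \<noteq> x" "v \<noteq> y"
    using 3(2) by (metis distinct.simps(2) last_ConsR last_in_set list.set_intros(1))
  then show ?case
  proof cases
    case 1
    then have "{#e \<in># path_mset (y # zs). v \<in> e#} = {#}"
      using path_mset_edge_subset[of _ "y # zs"] 3(2) by (auto simp: filter_mset_eq_conv)
    then show ?thesis using 1 by simp
  qed (use IH in auto)
qed auto

lemma cycle_on_degree_le_2:
  assumes "cycle_on V C"
  shows "finite C \<and> card {e \<in> C. v \<in> e} \<le> 2"
proof -
  obtain c where c: "distinct c" "3 \<le> length c" "C = insert {last c, hd c} (path_edges c)"
    using assms unfolding cycle_on_def by blast
  have fin: "finite C" unfolding c(3) by (simp flip: set_path_mset)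
  have "card {e \<in> C. v \<in> e} = size {#e \<in># cycle_mset c. v \<in> e#}"
    unfolding cycle_mset_distinct[OF c(1,2)] c(3)[symmetric] using fin by simp
  also have "\<dots> \<le> 2"
    using path_mset_degree[OF c(1), of v] c(2) by (cases "c = []") (auto simp: cycle_mset_def)
  finally show ?thesis using fin by blast
qed

text \<open>Every edge at \<open>v\<close> lies on some cycle of the cover, and each cycle has at
  most two edges at \<open>v\<close>.\<close>

lemma degree_le_c2:
  assumes "simple_graph G"
  shows "enat (degree G v div 2) \<le> c2 G"
  unfolding c2_def
proof (rule INF_greatest)
  fix \<C> assume "\<C> \<in> {\<C>. cycle_odd_cover G \<C>}"
  then have \<C>: "finite \<C>" "\<And>C. C \<in> \<C> \<Longrightarrow> cycle_on (verts G) C"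
    "{e. odd (card {C \<in> \<C>. e \<in> C})} = edges G"
    by (auto simp: cycle_odd_cover_def)
  have "{e \<in> edges G. v \<in> e} \<subseteq> (\<Union>C\<in>\<C>. {e \<in> C. v \<in> e})"
  proof
    fix e assume e: "e \<in> {e \<in> edges G. v \<in> e}"
    then have "odd (card {C \<in> \<C>. e \<in> C})" using \<C>(3) by blast
    then have "{C \<in> \<C>. e \<in> C} \<noteq> {}" by (metis card.empty even_zero)
    then show "e \<in> (\<Union>C\<in>\<C>. {e \<in> C. v \<in> e})" using e by blast
  qed
  then have "degree G v \<le> card (\<Union>C\<in>\<C>. {e \<in> C. v \<in> e})"
    unfolding degree_def using \<C>(1) cycle_on_degree_le_2[OF \<C>(2)]
    by (intro card_mono) auto
  also have "\<dots> \<le> (\<Sum>C\<in>\<C>. card {e \<in> C. v \<in> e})" using \<C>(1) by (rule card_UN_le)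
  also have "\<dots> \<le> (\<Sum>C\<in>\<C>. 2)" using cycle_on_degree_le_2[OF \<C>(2)] by (intro sum_mono) auto
  finally show "enat (degree G v div 2) \<le> enat (card \<C>)" by simp
qed

lemma simple_graph_embed: "simple_graph G \<Longrightarrow> simple_graph (embed G)"
  unfolding simple_graph_def embed_def by (auto simp: card_image)

lemma inj_image_Inl: "inj ((`) Inl)"
  by (rule injI) (simp add: inj_image_eq_iff)

lemma degree_embed: "degree (embed G) (Inl v) = degree G v"
proof -
  have "{e \<in> edges (embed G). Inl v \<in> e} = (`) Inl ` {e \<in> edges G. v \<in> e}"
    by (auto simp: embed_def)
  then show ?thesis
    unfolding degree_def using card_image[OF inj_on_subset[OF inj_image_Inl subset_UNIV]] by simp
qed

text \<open>A vertex of maximum degree keeps its degree in every subdivision.\<close>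

lemma max_degree_le_c2_top:
  assumes "simple_graph G"
  shows "enat (max_degree G div 2) \<le> c2_top G"
  unfolding c2_top_def
proof (rule INF_greatest)
  fix H assume "H \<in> {H. subdivision (embed G) H}"
  then have H: "simple_graph H" "\<forall>x\<in>verts (embed G). degree H x = degree (embed G) x"
    using subdivision_degree[OF _ simple_graph_embed[OF assms]] by auto
  have "max_degree G \<in> insert 0 (degree G ` verts G)"
    unfolding max_degree_def using assms by (intro Max_in) (auto simp: simple_graph_def)
  then show "enat (max_degree G div 2) \<le> c2 H"
  proof
    assume "max_degree G \<in> degree G ` verts G"
    then obtain v where v: "v \<in> verts G" "max_degree G = degree G v" by auto
    then have "Inl v \<in> verts (embed G)" by (simp add: embed_def)
    then have "degree H (Inl v) = max_degree G"
      using H(2) degree_embed[of G v] v(2) by simp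
    then show ?thesis using degree_le_c2[OF H(1), of "Inl v"] by simp
  qed (simp flip: zero_enat_def)
qed

section \<open>Giving every cycle new end vertices\<close>

text \<open>The closing edge from \<open>u\<close> to \<open>v\<close> becomes the path
  \<open>u\<close>, \<open>x\<close>, \<open>y\<close>, \<open>v\<close>. Listing the longer cycle
  from \<open>y\<close> to \<open>x\<close> makes the middle edge the closing edge, so both of its
  ends are new. \<open>R\<close> holds the other edges.\<close>

lemma subdivide_cycle:
  fixes H :: "'a graph"
  assumes inf: "infinite (UNIV :: 'a set)" and sub: "subdivision G H" and H: "simple_graph H"
    and M: "mset_set (edges H) = cycle_mset c + R" and c: "is_cycle (verts H) c"
  shows "\<exists>x y H'. x \<noteq> y \<and> x \<notin> verts H \<and> y \<notin> verts H \<and> subdivision G H' \<and> simple_graph H' \<and>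
    verts H' = insert x (insert y (verts H)) \<and> mset_set (edges H') = cycle_mset (y # c @ [x]) + R"
proof -
  have finV: "finite (verts H)" and finE: "finite (edges H)"
    using H simple_graph_finite_edges by (auto simp: simple_graph_def)
  obtain x where x: "x \<notin> verts H" using ex_new_if_finite[OF inf finV] by blast
  obtain y where y: "y \<notin> insert x (verts H)"
    using ex_new_if_finite[OF inf, of "insert x (verts H)"] finV by auto
  define u v where "u = last c" and "v = hd c"
  have ne: "c \<noteq> []" using c by (auto simp: is_cycle_def)
  have uv: "u \<in> verts H" "v \<in> verts H" using c ne by (auto simp: is_cycle_def u_def v_def)
  have "{u, v} \<in># mset_set (edges H)" unfolding M by (simp add: cycle_mset_def u_def v_def)
  then have uvE: "{u, v} \<in> edges H" using finE by simp
  define E0 where "E0 = edges H - {{u, v}}"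
  have "mset_set E0 = path_mset c + R"
    unfolding E0_def using M finE uvE
    by (simp add: mset_set_Diff cycle_mset_def u_def v_def)
  define H1 where "H1 = Graph (insert x (verts H)) (edges H - {{u, v}} \<union> {{u, x}, {x, v}})"
  have sub1: "subdivision G H1" unfolding H1_def by (rule subdivision_step[OF sub uvE x])
  have simple1: "simple_graph H1" by (rule subdivision_step_degree(1)[OF H uvE x H1_def])
  have xvE: "{x, v} \<in> edges H1" by (simp add: H1_def)
  have y1: "y \<notin> verts H1" using y by (simp add: H1_def)
  define H2 where "H2 = Graph (insert y (verts H1)) (edges H1 - {{x, v}} \<union> {{x, y}, {y, v}})"
  have sub2: "subdivision G H2" unfolding H2_def by (rule subdivision_step[OF sub1 xvE y1])
  have simple2: "simple_graph H2" by (rule subdivision_step_degree(1)[OF simple1 xvE y1 H2_def])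
  have "x \<noteq> u" "x \<noteq> v" "y \<noteq> u" "y \<noteq> v" "x \<noteq> y" "u \<noteq> v"
    using x y uv uvE H by (auto simp: simple_graph_def)
  moreover have notE0: "{x, z} \<notin> E0" "{z, x} \<notin> E0" "{y, z} \<notin> E0" for z
    using x y H by (auto simp: E0_def simple_graph_def)
  ultimately have "edges H2 = insert {u, x} (insert {x, y} (insert {y, v} E0))"
    unfolding H2_def H1_def E0_def by (auto simp: doubleton_eq_iff)
  moreover have "mset_set (insert {u, x} (insert {x, y} (insert {y, v} E0))) =
      {#{u, x}, {x, y}, {y, v}#} + mset_set E0"
    using notE0 finE \<open>x \<noteq> v\<close> \<open>y \<noteq> u\<close> \<open>x \<noteq> y\<close> \<open>u \<noteq> v\<close> \<open>x \<noteq> u\<close> \<open>y \<noteq> v\<close>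
    by (simp add: E0_def doubleton_eq_iff)
  moreover have "cycle_mset (y # c @ [x]) = {#{u, x}, {x, y}, {y, v}#} + path_mset c"
    using ne by (simp add: cycle_mset_def path_mset_Cons path_mset_snoc u_def v_def)
  ultimately have "mset_set (edges H2) = cycle_mset (y # c @ [x]) + R"
    using \<open>mset_set E0 = path_mset c + R\<close> by simp
  moreover have "verts H2 = insert x (insert y (verts H))" by (auto simp: H2_def H1_def)
  ultimately show ?thesis using x y sub2 simple2
    by (intro exI[of _ x] exI[of _ y] exI[of _ H2]) auto
qed

text \<open>The bound on the old vertices of \<open>F'\<close> carries disjointness through the
  induction: an extended cycle lies in the current graph, where the cycles treated later keep to
  their old vertices. \<open>R\<close> takes up the cycles already extended.\<close>

lemma subdivide_system:
  fixes H :: "'a graph"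
  assumes "infinite (UNIV :: 'a set)" "subdivision G H" "simple_graph H"
    "mset_set (edges H) = (\<Sum>c\<leftarrow>F. cycle_mset c) + R" "cycle_system (verts H) F"
  shows "\<exists>H' F'. subdivision G H' \<and> simple_graph H' \<and> verts H \<subseteq> verts H' \<and>
    mset_set (edges H') = (\<Sum>c\<leftarrow>F'. cycle_mset c) + R \<and> cycle_system (verts H') F' \<and>
    set (concat F') \<inter> verts H \<subseteq> set (concat F) \<and> (\<forall>c\<in>set F'. set (ends c) \<inter> verts H = {})"
  using assms(2-)
proof (induction F arbitrary: H R)
  case Nil
  then show ?case by (intro exI[of _ H] exI[of _ "[]"]) (simp add: cycle_system_def)
next
  case (Cons c F)
  have c: "is_cycle (verts H) c" and F: "cycle_system (verts H) F"
    and cF: "set c \<inter> set (concat F) = {}"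
    using Cons.prems(4) by (auto simp: cycle_system_def)
  obtain x y H1 where 1: "x \<noteq> y" "x \<notin> verts H" "y \<notin> verts H" "subdivision G H1" "simple_graph H1"
    "verts H1 = insert x (insert y (verts H))"
    "mset_set (edges H1) = cycle_mset (y # c @ [x]) + ((\<Sum>c\<leftarrow>F. cycle_mset c) + R)"
    using subdivide_cycle[OF assms(1) Cons.prems(1,2) _ c, of "(\<Sum>c\<leftarrow>F. cycle_mset c) + R"] Cons.prems(3)
    by (auto simp: add.assoc)
  have "cycle_system (verts H1) F"
    using F 1(6) by (auto simp: cycle_system_def is_cycle_def)
  moreover have "mset_set (edges H1) = (\<Sum>c\<leftarrow>F. cycle_mset c) + (cycle_mset (y # c @ [x]) + R)"
    using 1(7) by (simp add: ac_simps)
  ultimately obtain H' F' where 2: "subdivision G H'" "simple_graph H'" "verts H1 \<subseteq> verts H'"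
    "mset_set (edges H') = (\<Sum>c\<leftarrow>F'. cycle_mset c) + (cycle_mset (y # c @ [x]) + R)"
    "cycle_system (verts H') F'" "set (concat F') \<inter> verts H1 \<subseteq> set (concat F)"
    "\<forall>c\<in>set F'. set (ends c) \<inter> verts H1 = {}"
    using Cons.IH[OF 1(4,5)] by blast
  have cV: "set c \<subseteq> verts H" "distinct c" "3 \<le> length c" using c by (auto simp: is_cycle_def)
  have new: "set (y # c @ [x]) \<subseteq> verts H1" using cV 1(6) by auto
  have "is_cycle (verts H') (y # c @ [x])"
    using cV 1(1-3) new 2(3) by (auto simp: is_cycle_def)
  moreover have "set (y # c @ [x]) \<inter> set (concat F') = {}"
  proof -
    have "set (concat F) \<subseteq> verts H" by (rule cycle_system_subset[OF F])
    then have "set (y # c @ [x]) \<inter> set (concat F) = {}" using cF 1(2,3) by auto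
    then show ?thesis using 2(6) new by blast
  qed
  ultimately have "cycle_system (verts H') ((y # c @ [x]) # F')"
    using 2(5) by (auto simp: cycle_system_def is_cycle_def)
  moreover have "mset_set (edges H') = (\<Sum>c\<leftarrow>(y # c @ [x]) # F'. cycle_mset c) + R"
    using 2(4) by (simp add: ac_simps)
  moreover have "set (concat ((y # c @ [x]) # F')) \<inter> verts H \<subseteq> set (concat (c # F))"
    using 1(2,3,6) 2(6) by auto
  moreover have "\<forall>c\<in>set ((y # c @ [x]) # F'). set (ends c) \<inter> verts H = {}"
    using 1(2,3,6) 2(7) by auto
  moreover have "verts H \<subseteq> verts H'" using 1(6) 2(3) by auto
  ultimately show ?case using 2(1,2)
    by (intro exI[of _ H'] exI[of _ "(y # c @ [x]) # F'"] conjI)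
qed

text \<open>Systems treated later meet the current graph only within \<open>W\<close>, whereas the
  ends made for an earlier system lie outside \<open>verts H\<close>, which contains
  \<open>W\<close>. Conversely, ends made later are new to the graph that contains the earlier
  cycles. Together this is separation.\<close>

lemma subdivide_systems:
  fixes H :: "'a graph"
  assumes "infinite (UNIV :: 'a set)" "subdivision G H" "simple_graph H"
    "mset_set (edges H) = (\<Sum>F\<leftarrow>Fs. \<Sum>c\<leftarrow>F. cycle_mset c) + R"
    "\<forall>F\<in>set Fs. cycle_system W F" "W \<subseteq> verts H"
  shows "\<exists>H' Fs'. subdivision G H' \<and> simple_graph H' \<and> verts H \<subseteq> verts H' \<and> length Fs' = length Fs \<and>
    mset_set (edges H') = (\<Sum>F\<leftarrow>Fs'. \<Sum>c\<leftarrow>F. cycle_mset c) + R \<and>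
    (\<forall>F\<in>set Fs'. cycle_system (verts H') F \<and> set (concat F) \<inter> verts H \<subseteq> W \<and>
      (\<forall>c\<in>set F. set (ends c) \<inter> verts H = {})) \<and> sorted_wrt separated Fs'"
  using assms(2-)
proof (induction Fs arbitrary: H R)
  case Nil
  then show ?case by (intro exI[of _ H] exI[of _ "[]"]) simp
next
  case (Cons F Fs)
  have F: "cycle_system (verts H) F" "set (concat F) \<subseteq> W"
    using Cons.prems(4,5) cycle_system_subset[of W F]
    by (auto simp: cycle_system_def is_cycle_def)
  obtain H1 F' where 1: "subdivision G H1" "simple_graph H1" "verts H \<subseteq> verts H1"
    "mset_set (edges H1) = (\<Sum>c\<leftarrow>F'. cycle_mset c) + ((\<Sum>F\<leftarrow>Fs. \<Sum>c\<leftarrow>F. cycle_mset c) + R)"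
    "cycle_system (verts H1) F'" "set (concat F') \<inter> verts H \<subseteq> set (concat F)"
    "\<forall>c\<in>set F'. set (ends c) \<inter> verts H = {}"
    using subdivide_system[OF assms(1) Cons.prems(1,2) _ F(1), of "(\<Sum>F\<leftarrow>Fs. \<Sum>c\<leftarrow>F. cycle_mset c) + R"]
      Cons.prems(3) by (auto simp: add.assoc)
  have "mset_set (edges H1) = (\<Sum>F\<leftarrow>Fs. \<Sum>c\<leftarrow>F. cycle_mset c) + ((\<Sum>c\<leftarrow>F'. cycle_mset c) + R)"
    using 1(4) by (simp add: ac_simps)
  moreover have "W \<subseteq> verts H1" using Cons.prems(5) 1(3) by blast
  ultimately obtain H' Fs' where 2: "subdivision G H'" "simple_graph H'" "verts H1 \<subseteq> verts H'"
    "length Fs' = length Fs"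
    "mset_set (edges H') = (\<Sum>F\<leftarrow>Fs'. \<Sum>c\<leftarrow>F. cycle_mset c) + ((\<Sum>c\<leftarrow>F'. cycle_mset c) + R)"
    "\<forall>F\<in>set Fs'. cycle_system (verts H') F \<and> set (concat F) \<inter> verts H1 \<subseteq> W \<and>
      (\<forall>c\<in>set F. set (ends c) \<inter> verts H1 = {})" "sorted_wrt separated Fs'"
    using Cons.IH[OF 1(1,2)] Cons.prems(4) by (metis list.set_intros(2))
  have F'V: "set (concat F') \<subseteq> verts H1" by (rule cycle_system_subset[OF 1(5)])
  have "separated F' G" if G: "G \<in> set Fs'" for G
    unfolding separated_def
  proof (intro conjI ballI)
    fix c assume c: "c \<in> set F'"
    then have "c \<noteq> []" using 1(5) by (auto simp: cycle_system_def is_cycle_def)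
    moreover have "set c \<subseteq> set (concat F')" using c by auto
    ultimately have "set (ends c) \<subseteq> set (concat F')" using set_ends by blast
    then show "set (ends c) \<inter> set (concat G) = {}"
      using 1(7) c 2(6) G F'V Cons.prems(5) by blast
  next
    fix c assume "c \<in> set G"
    then show "set (ends c) \<inter> set (concat F') = {}" using 2(6) G F'V by blast
  qed
  moreover have "cycle_system (verts H') F'"
    using 1(5) 2(3) by (auto simp: cycle_system_def is_cycle_def)
  moreover have "set (concat F') \<inter> verts H \<subseteq> W" using 1(6) F(2) by blast
  moreover have "mset_set (edges H') = (\<Sum>F\<leftarrow>F' # Fs'. \<Sum>c\<leftarrow>F. cycle_mset c) + R"
    using 2(5) by (simp add: ac_simps)
  moreover have "\<forall>F\<in>set Fs'. cycle_system (verts H') F \<and> set (concat F) \<inter> verts H \<subseteq> W \<and>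
      (\<forall>c\<in>set F. set (ends c) \<inter> verts H = {})"
    using 2(6) 1(3) by blast
  moreover have "verts H \<subseteq> verts H'" using 1(3) 2(3) by blast
  ultimately show ?case using 1(7) 2(1,2,4,7) by (intro exI[of _ H'] exI[of _ "F' # Fs'"]) simp
qed

section \<open>Transfer to the larger vertex type and the upper bound for subdivisions\<close>

lemma path_mset_map: "path_mset (map f p) = image_mset ((`) f) (path_mset p)"
  by (induction p rule: path_mset.induct) auto

lemma cycle_mset_map: "c \<noteq> [] \<Longrightarrow> cycle_mset (map f c) = image_mset ((`) f) (cycle_mset c)"
  by (simp add: cycle_mset_def path_mset_map hd_map last_map)

lemma image_mset_sum_list: "image_mset f (\<Sum>x\<leftarrow>xs. g x) = (\<Sum>x\<leftarrow>xs. image_mset f (g x))"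
  by (induction xs) auto

lemma mset_set_edges_embed:
  "mset_set (edges (embed G)) = image_mset ((`) Inl) (mset_set (edges G))"
  unfolding embed_def using image_mset_mset_set[OF inj_on_subset[OF inj_image_Inl subset_UNIV]]
  by (metis graph.sel(2))

lemma cycle_system_map_Inl:
  "cycle_system (verts G) F \<Longrightarrow> cycle_system (verts (embed G)) (map (map Inl) F)"
  by (auto simp: cycle_system_def is_cycle_def distinct_map embed_def map_concat[symmetric] inj_on_def)

text \<open>Used contrapositively for a single system. Cycles on disjoint vertex sets have different
  edge sets, so passing from lists to edge sets loses none.\<close>

lemma union_of_disjoint_cyclesI:
  assumes F: "cycle_system (verts G) F" "2 \<le> length F"
    and sum: "(\<Sum>c\<leftarrow>F. cycle_mset c) = mset_set (edges G)" and fin: "finite (edges G)"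
  shows "union_of_disjoint_cycles G"
proof -
  define h where "h c = insert {last c, hd c} (path_edges c)" for c :: "'a list"
  have cyc: "distinct c" "3 \<le> length c" "set c \<subseteq> verts G" "c \<noteq> []" if "c \<in> set F" for c
    using that F(1) by (auto simp: cycle_system_def is_cycle_def)
  have seth: "set_mset (cycle_mset c) = h c" for c by (simp add: cycle_mset_def h_def set_path_mset)
  have Un: "\<Union>(h c) \<subseteq> set c" if "c \<in> set F" for c
    using cycle_mset_edge_subset[of c] cyc(4)[OF that] seth by blast
  have ne: "hd c \<in> \<Union>(h c)" for c by (simp add: h_def)
  have disj: "set c \<inter> set d = {}" if "c \<in> set F" "d \<in> set F" "c \<noteq> d" for c d
    using that F(1) by (auto simp: cycle_system_def distinct_concat_iff)
  have "inj_on h (set F)"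
  proof (rule inj_onI, rule ccontr)
    fix c d assume cd: "c \<in> set F" "d \<in> set F" "h c = h d" "c \<noteq> d"
    have "hd c \<in> set c" using ne Un[OF cd(1)] by blast
    moreover have "hd c \<in> set d" using ne[of c] Un[OF cd(2)] unfolding cd(3) by blast
    ultimately show False using disj[OF cd(1,2,4)] by blast
  qed
  moreover have "distinct F"
  proof -
    \<comment> \<open>Distinctness of a concatenation says nothing about repeated empty lists, but
      no cycle is empty.\<close>
    have "removeAll [] F = F" using cyc(4) by (intro removeAll_id) blast
    then show ?thesis using F(1) by (simp add: cycle_system_def distinct_concat_iff)
  qed
  ultimately have "card (h ` set F) = length F" by (simp add: card_image distinct_card)
  moreover have "\<Union>(h ` set F) = edges G"
  proof -
    have "\<Union>(h ` set F) = set_mset (\<Sum>c\<leftarrow>F. cycle_mset c)"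
      using seth by (induction F) auto
    then show ?thesis using sum fin by simp
  qed
  moreover have "\<forall>C\<in>h ` set F. cycle_on (verts G) C"
    using cyc unfolding cycle_on_def h_def by blast
  moreover have "pairwise (\<lambda>C D. \<Union>C \<inter> \<Union>D = {}) (h ` set F)"
  proof (intro pairwiseI)
    fix C D assume "C \<in> h ` set F" "D \<in> h ` set F" "C \<noteq> D"
    then obtain c d where "c \<in> set F" "d \<in> set F" "C = h c" "D = h d" "c \<noteq> d" by blast
    then show "\<Union>C \<inter> \<Union>D = {}" using disj[of c d] Un[of c] Un[of d] by blast
  qed
  ultimately show ?thesis unfolding union_of_disjoint_cycles_def using F(2)
    by (intro exI[of _ "h ` set F"]) simp
qed

text \<open>Two or more systems are separated by subdividing. A single system has at most one cycle
  because \<open>G\<close> is not a union of disjoint cycles, and without systems there are no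
  edges; in both cases \<open>embed G\<close> itself serves.\<close>

lemma c2_top_le_max_degree:
  fixes G :: "'a graph"
  assumes G: "simple_graph G" "eulerian G" and not_union: "\<not> union_of_disjoint_cycles G"
  shows "c2_top G \<le> enat (max_degree G div 2)"
proof -
  define k where "k = max_degree G div 2"
  obtain Fs where Fs: "length Fs = k"
     "\<And>F. F \<in> set Fs \<Longrightarrow> cycle_system (verts G) F"
     "(\<Sum>F\<leftarrow>Fs. \<Sum>c\<leftarrow>F. cycle_mset c) = mset_set (edges G)"
    using eulerian_cycle_systems[OF G] unfolding cycle_system_def k_def by blast
  define Fs' :: "('a + nat) list list list" where "Fs' = map (map (map Inl)) Fs"
  have simple: "simple_graph (embed G)" by (rule simple_graph_embed[OF G(1)])
  have Fs': "cycle_system (verts (embed G)) F" if "F \<in> set Fs'" for F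
    using that cycle_system_map_Inl Fs(2) by (auto simp: Fs'_def)
  have ne: "c \<noteq> []" if "F \<in> set Fs" "c \<in> set F" for F c
    using that(2) Fs(2)[OF that(1)] by (auto simp: cycle_system_def is_cycle_def)
  have sum: "(\<Sum>F\<leftarrow>Fs'. \<Sum>c\<leftarrow>F. cycle_mset c) = mset_set (edges (embed G))"
    unfolding mset_set_edges_embed Fs(3)[symmetric] image_mset_sum_list Fs'_def
    using ne by (auto simp: comp_def cycle_mset_map intro!: arg_cong[of _ _ sum_list] map_cong)
  have "\<exists>H. subdivision (embed G) H \<and> simple_graph H \<and> covered (verts H) k (mset_set (edges H))"
  proof (cases "2 \<le> k")
    case True
    have inf: "infinite (UNIV :: ('a + nat) set)" by simp
    obtain H Hs where H: "subdivision (embed G) H" "simple_graph H" "length Hs = length Fs'"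
        "mset_set (edges H) = (\<Sum>F\<leftarrow>Hs. \<Sum>c\<leftarrow>F. cycle_mset c)"
        "\<forall>F\<in>set Hs. cycle_system (verts H) F" "sorted_wrt separated Hs"
      using subdivide_systems[OF inf subdivision_refl simple, of Fs' "{#}" "verts (embed G)"] sum Fs'
      by auto
    have "length Hs = k" using H(3) Fs(1) by (simp add: Fs'_def)
    then have "covered (verts H) k (mset_set (edges H))"
      using covered_systems[of Hs "verts H"] H True by simp
    then show ?thesis using H(1,2) by blast
  next
    case False
    have "covered (verts (embed G)) k (mset_set (edges (embed G)))"
    proof (cases "k = 0")
      case True
      then have "mset_set (edges (embed G)) = {#}"
        using Fs(1) sum[symmetric] by (simp add: Fs'_def)
      then show ?thesis by simp
    next
      case False
      with \<open>\<not> 2 \<le> k\<close> have k1: "k = 1" by simp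
      then obtain F where F: "Fs = [F]" using Fs(1) by (auto simp: length_Suc_conv)
      have "\<not> 2 \<le> length F"
        using union_of_disjoint_cyclesI[of G F] not_union Fs(2,3) simple_graph_finite_edges[OF G(1)]
        by (auto simp: F)
      then consider "F = []" | c where "F = [c]" by (cases F; cases "tl F") auto
      then show ?thesis
      proof cases
        case 1
        then show ?thesis using sum by (simp add: Fs'_def F)
      next
        case (2 c)
        then have "is_cycle (verts (embed G)) (map Inl c)"
          using Fs' by (simp add: Fs'_def F cycle_system_def)
        then have "covered (verts (embed G)) 1 (cycle_mset (map Inl c))" by (rule covered_cycle)
        then show ?thesis using sum k1 by (simp add: Fs'_def F 2)
      qed
    qed
    then show ?thesis using subdivision_refl simple by blast
  qed
  then obtain H where H: "subdivision (embed G) H" "simple_graph H"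
    "covered (verts H) k (mset_set (edges H))" by blast
  have "c2_top G \<le> c2 H" unfolding c2_top_def using H(1) by (intro INF_lower) simp
  also have "\<dots> \<le> enat k"
    using c2_le_covered[OF H(3) odd_part_mset_set[OF simple_graph_finite_edges[OF H(2)]]] .
  finally show ?thesis by (simp add: k_def)
qed

section \<open>Closing linear forests to cycles\<close>

text \<open>Isolated vertices of a forest are left out, so that every path has two different
  ends.\<close>

definition path_system :: "'a list list \<Rightarrow> bool" where
  "path_system L \<longleftrightarrow> distinct (concat L) \<and> (\<forall>p\<in>set L. 2 \<le> length p)"

abbreviation system_mset :: "'a list list \<Rightarrow> 'a set multiset" where
  "system_mset L \<equiv> (\<Sum>p\<leftarrow>L. path_mset p)"

text \<open>For a path system these are the vertices of odd degree, by
  \<open>odd_system_degree\<close>.\<close>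

definition tips :: "'a list list \<Rightarrow> 'a set" where
  "tips L = (\<Union>p\<in>set L. {hd p, last p})"

lemma tips_simps [simp]: "tips [] = {}" "tips (p # L) = {hd p, last p} \<union> tips L"
  by (auto simp: tips_def)

lemma path_system_simps [simp]:
  "path_system []"
  "path_system (p # L) \<longleftrightarrow> distinct p \<and> 2 \<le> length p \<and> set p \<inter> set (concat L) = {} \<and> path_system L"
  by (auto simp: path_system_def)

lemma long_path_hd_last:
  assumes "2 \<le> length p"
  shows "p \<noteq> []" "hd p \<in> set p" "last p \<in> set p" "distinct p \<Longrightarrow> hd p \<noteq> last p"
proof -
  show "p \<noteq> []" using assms by auto
  then show "hd p \<in> set p" "last p \<in> set p" by auto
  show "hd p \<noteq> last p" if "distinct p" using that assms by (cases p) auto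
qed

lemma tips_subset: "path_system L \<Longrightarrow> tips L \<subseteq> set (concat L)"
proof (induction L)
  case (Cons p L)
  then show ?case using long_path_hd_last(2,3)[of p] by auto
qed simp

lemma path_system_Cons_tips:
  assumes "path_system (p # L)"
  shows "p \<noteq> []" "hd p \<noteq> last p" "{hd p, last p} \<inter> tips L = {}"
proof -
  have p: "distinct p" "2 \<le> length p" "set p \<inter> set (concat L) = {}" "path_system L"
    using assms by simp_all
  show "p \<noteq> []" "hd p \<noteq> last p" using long_path_hd_last[OF p(2)] p(1) by auto
  have "{hd p, last p} \<subseteq> set p" using long_path_hd_last(2,3)[OF p(2)] by simp
  then show "{hd p, last p} \<inter> tips L = {}" using p(3) tips_subset[OF p(4)] by blast
qed

text \<open>The tips determine the number of paths, so forests with equal tips have equally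
  many.\<close>

lemma card_tips: "path_system L \<Longrightarrow> finite (tips L) \<and> card (tips L) = 2 * length L"
proof (induction L)
  case (Cons p L)
  show ?case
    using Cons path_system_Cons_tips[OF Cons.prems] by (simp add: card_Un_disjoint)
qed simp

text \<open>Reordering the paths and reversing one of them changes neither edges nor tips, so any
  tip may be assumed to end the first path.\<close>

lemma path_system_front:
  assumes "path_system L" "a \<in> tips L"
  shows "\<exists>p L'. path_system (p # L') \<and> last p = a \<and> tips (p # L') = tips L \<and>
    set (concat (p # L')) = set (concat L) \<and> system_mset (p # L') = system_mset L \<and>
    length L = Suc (length L')"
proof -
  obtain q where q: "q \<in> set L" "a = hd q \<or> a = last q" using assms(2) by (auto simp: tips_def)
  obtain As Bs where L: "L = As @ q # Bs" using q(1) by (auto simp: in_set_conv_decomp)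
  define p where "p = (if a = last q then q else rev q)"
  have "2 \<le> length q" using assms(1) q(1) by (auto simp: path_system_def)
  then have "q \<noteq> []" by auto
  then have p: "last p = a" "set p = set q" "length p = length q" "{hd p, last p} = {hd q, last q}"
    "path_mset p = path_mset q" "distinct p = distinct q"
    using q(2) by (auto simp: p_def last_rev hd_rev)
  have "path_system (p # As @ Bs)"
    using assms(1) p(2,3,6) by (auto simp: L path_system_def)
  moreover have "tips (p # As @ Bs) = tips L"
    unfolding tips_def L using p(4) by auto
  moreover have "set (concat (p # As @ Bs)) = set (concat L)"
    using p(2) by (auto simp: L)
  moreover have "system_mset (p # As @ Bs) = system_mset L"
    using p(5) by (simp add: L)
  ultimately show ?thesis using p(1) by (intro exI[of _ p] exI[of _ "As @ Bs"]) (simp add: L)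
qed

lemma path_system_front_hd:
  assumes "path_system L" "a \<in> tips L"
  shows "\<exists>p L'. path_system (p # L') \<and> hd p = a \<and> tips (p # L') = tips L \<and>
    set (concat (p # L')) = set (concat L) \<and> system_mset (p # L') = system_mset L \<and>
    length L = Suc (length L')"
proof -
  obtain p L' where p: "path_system (p # L')" "last p = a" "tips (p # L') = tips L"
    "set (concat (p # L')) = set (concat L)" "system_mset (p # L') = system_mset L"
    "length L = Suc (length L')"
    using path_system_front[OF assms] by blast
  have "p \<noteq> []" using p(1) by auto
  then show ?thesis using p by (intro exI[of _ "rev p"] exI[of _ L']) (auto simp: hd_rev last_rev)
qed

lemma path_system_extend:
  assumes L: "path_system L" and b: "b \<in> set (concat L) \<longrightarrow> b \<in> tips L"
    and y: "y \<notin> set (concat L)" "y \<noteq> b"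
  shows "\<exists>L'. path_system L' \<and> system_mset L' = add_mset {b, y} (system_mset L) \<and>
    set (concat L') = insert b (insert y (set (concat L))) \<and>
    (\<forall>v. v \<in> tips L' \<longleftrightarrow> (v \<in> tips L) \<noteq> (v = b \<or> v = y))"
proof (cases "b \<in> tips L")
  case True
  obtain p K where p: "path_system (p # K)" "last p = b" "tips (p # K) = tips L"
    "set (concat (p # K)) = set (concat L)" "system_mset (p # K) = system_mset L"
    using path_system_front[OF L True] by blast
  have yp: "y \<notin> set p" "y \<notin> set (concat K)" using y(1) p(4) by auto
  have ne: "p \<noteq> []" "hd p \<in> set p" "b \<in> set p" "hd p \<noteq> b"
    using long_path_hd_last[of p] p(1,2) by auto
  have bK: "b \<notin> tips K" using p(1) ne(3) tips_subset[of K] by auto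
  have "path_system ((p @ [y]) # K)" using p(1) yp by auto
  moreover have "system_mset ((p @ [y]) # K) = add_mset {b, y} (system_mset L)"
    using p(2,5) ne(1) by (simp add: path_mset_snoc flip: p(5))
  moreover have "set (concat ((p @ [y]) # K)) = insert b (insert y (set (concat L)))"
    using ne(3) unfolding p(4)[symmetric] by auto
  moreover have "v \<in> tips ((p @ [y]) # K) \<longleftrightarrow> (v \<in> tips L) \<noteq> (v = b \<or> v = y)" for v
  proof -
    have "y \<notin> tips L" using tips_subset[OF L] y(1) by blast
    then show ?thesis
      using ne(1,2,4) bK y(2) p(2) yp(1) unfolding p(3)[symmetric] by auto
  qed
  ultimately show ?thesis by blast
next
  case False
  then have b': "b \<notin> set (concat L)" using b by blast
  have "path_system ([b, y] # L)" using L b' y by auto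
  moreover have "v \<in> tips ([b, y] # L) \<longleftrightarrow> (v \<in> tips L) \<noteq> (v = b \<or> v = y)" for v
    using tips_subset[OF L] b' y(1) by auto
  ultimately show ?thesis by (intro exI[of _ "[b, y] # L"]) auto
qed

text \<open>The new edge links \<open>p\<close> to a different path, so no cycle arises; its two
  ends become inner vertices.\<close>

lemma path_system_join:
  assumes "path_system (p # L)" "b \<in> tips L"
  shows "\<exists>L'. path_system L' \<and> system_mset L' = add_mset {last p, b} (system_mset (p # L)) \<and>
    tips L' = tips (p # L) - {last p, b} \<and> set (concat L') = set (concat (p # L)) \<and>
    length L' = length L"
proof -
  obtain q K where q: "path_system (q # K)" "hd q = b" "tips (q # K) = tips L"
    "set (concat (q # K)) = set (concat L)" "system_mset (q # K) = system_mset L" "length L = Suc (length K)"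
    using path_system_front_hd[of L b] assms by auto
  have ne: "p \<noteq> []" "q \<noteq> []" "hd p \<in> set p" "last p \<in> set p" "hd p \<noteq> last p"
     "hd q \<in> set q" "last q \<in> set q" "hd q \<noteq> last q"
    using assms(1) q(1) long_path_hd_last[of p] long_path_hd_last[of q] by auto
  have pK: "set p \<inter> set (concat (q # K)) = {}" unfolding q(4) using assms(1) by simp
  have sub: "tips K \<subseteq> set (concat K)" using q(1) tips_subset[of K] by simp
  have "path_system ((p @ q) # K)" using assms(1) q(1) pK by auto
  moreover have "system_mset ((p @ q) # K) = add_mset {last p, b} (system_mset (p # L))"
    using ne(1,2) q(2) by (simp add: path_mset_append flip: q(5))
  moreover have "tips ((p @ q) # K) = tips (p # L) - {last p, b}"
  proof -
    have "tips (p # L) = {hd p, last p, hd q, last q} \<union> tips K" using q(3) by auto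
    moreover have "last p \<notin> tips K" "last p \<noteq> last q" "b \<notin> tips K" "b \<noteq> hd p"
      using pK ne(3,4,6,7) sub q(1,2) by auto
    ultimately show ?thesis using ne q(2) by auto
  qed
  moreover have "set (concat ((p @ q) # K)) = set (concat (p # L))" using q(4) by auto
  ultimately show ?thesis using q(6) by (intro exI[of _ "(p @ q) # K"]) simp
qed

subsection \<open>Two linear forests with the same ends\<close>

text \<open>Each step adds one edge to both forests, joining two different paths in each; the two
  copies cancel. At the end each forest is a single path between the same two vertices.\<close>

lemma covered_two_path_systems:
  fixes L K :: "'a list list"
  assumes inf: "infinite (UNIV :: 'a set)" and U: "finite U"
    and "path_system L" "path_system K" "tips L = tips K"
    "set (concat L) \<subseteq> U" "set (concat K) \<subseteq> U"
  shows "\<exists>W. finite W \<and> U \<subseteq> W \<and> covered W 2 (system_mset L + system_mset K)"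
  using assms(3-)
proof (induction "length L" arbitrary: L K)
  case 0
  then have "L = []" "K = []" using card_tips[of K] by auto
  then show ?case using U by auto
next
  case (Suc n)
  obtain p L' where L: "L = p # L'" using Suc.hyps(2) by (cases L) auto
  have len: "length K = length L" using card_tips[of L] card_tips[of K] Suc.prems by simp
  have "last p \<in> tips K" using Suc.prems(3) by (auto simp: L)
  then obtain q K' where K: "path_system (q # K')" "last q = last p" "tips (q # K') = tips K"
    "set (concat (q # K')) = set (concat K)" "system_mset (q # K') = system_mset K"
    "length K = Suc (length K')"
    using path_system_front[OF Suc.prems(2)] by blast
  show ?case
  proof (cases "n = 0")
    case True
    then have "L' = []" "K' = []" using Suc.hyps(2) len K(6) by (auto simp: L)
    have p: "distinct p" "2 \<le> length p" "set p \<subseteq> U" and q: "distinct q" "2 \<le> length q"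
      using Suc.prems(1,4) K(1) by (auto simp: L)
    have qU: "set q \<subseteq> U"
    proof -
      have "set q \<subseteq> set (concat (q # K'))" by simp
      then show ?thesis unfolding K(4) using Suc.prems(5) by blast
    qed
    have "{hd p, last p} = {hd q, last q}" using K(3) Suc.prems(3) \<open>L' = []\<close> \<open>K' = []\<close> by (simp add: L)
    then have hd: "hd p = hd q" using K(2) by (auto simp: doubleton_eq_iff)
    \<comment> \<open>A new vertex closes both paths. Without it a path on two vertices would not
      become a cycle.\<close>
    obtain y where y: "y \<notin> U" using ex_new_if_finite[OF inf U] by blast
    have "is_cycle (insert y U) (p @ [y])" "is_cycle (insert y U) (q @ [y])"
      using p q qU y by (auto simp: is_cycle_def)
    then have "covered (insert y U) (1 + 1) (cycle_mset (p @ [y]) + cycle_mset (q @ [y]))"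
      by (intro covered_add covered_cycle)
    moreover have "p \<noteq> []" "q \<noteq> []" using p q by auto
    then have "cycle_mset (p @ [y]) + cycle_mset (q @ [y]) =
        system_mset L + system_mset K + {#{y, hd p}, {last p, y}#} + {#{y, hd p}, {last p, y}#}"
      using hd K(2) \<open>L' = []\<close> \<open>K' = []\<close>
      by (simp add: cycle_mset_def path_mset_snoc L flip: K(5))
    ultimately have "covered (insert y U) 2 (system_mset L + system_mset K)"
      unfolding covered_cong[OF odd_part_double] by (metis one_add_one covered_cong odd_part_double)
    then show ?thesis using U by blast
  next
    case False
    have "card (tips L) = 2 * Suc n" using card_tips[of L] Suc.prems(1) Suc.hyps(2) by simp
    \<comment> \<open>\<open>last p\<close> must be linked to a tip off its own path in both
      forests, which rules out \<open>hd p\<close>, \<open>last p\<close> and \<open>hd q\<close>.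
      At least two paths have at least four tips, so one is left.\<close>
    then have "\<not> tips L \<subseteq> {hd p, last p, hd q}"
      using False card_mono[of "{hd p, last p, hd q}" "tips L"]
        card_insert_le_m1[of 3 "{last p, hd q}" "hd p"] card_insert_le_m1[of 2 "{hd q}" "last p"]
      by auto
    then obtain b where b: "b \<in> tips L" "b \<noteq> hd p" "b \<noteq> last p" "b \<noteq> hd q" by blast
    have "b \<in> tips L'" using b by (simp add: L)
    then obtain L1 where L1: "path_system L1" "system_mset L1 = add_mset {last p, b} (system_mset L)"
      "tips L1 = tips L - {last p, b}" "set (concat L1) = set (concat L)" "length L1 = n"
      using path_system_join[of p L' b] Suc.prems(1) Suc.hyps(2) by (auto simp: L)
    have "b \<in> tips K'" using b K(2,3) Suc.prems(3) by auto
    then obtain K1 where K1: "path_system K1" "system_mset K1 = add_mset {last p, b} (system_mset K)"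
      "tips K1 = tips K - {last p, b}" "set (concat K1) = set (concat K)"
      using path_system_join[OF K(1)] unfolding K(2-5) by blast
    obtain W where W: "finite W" "U \<subseteq> W" "covered W 2 (system_mset L1 + system_mset K1)"
      using Suc.hyps(1)[of L1 K1] L1 K1 Suc.prems(3-5) by auto
    have "system_mset L1 + system_mset K1 =
        system_mset L + system_mset K + {#{last p, b}#} + {#{last p, b}#}"
      using L1(2) K1(2) by simp
    then have "covered W 2 (system_mset L + system_mset K)"
      using W(3) covered_cong[OF odd_part_double] by metis
    then show ?thesis using W(1,2) by blast
  qed
qed

subsection \<open>Three or more linear forests\<close>

text \<open>The invariant in place of degrees: for path systems it is the parity of the degree in
  the multiset sum, by \<open>odd_tip_degree\<close>.\<close>

definition odd_tip :: "'a list list list \<Rightarrow> 'a \<Rightarrow> bool" where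
  "odd_tip Ls v \<longleftrightarrow> odd (\<Sum>L\<leftarrow>Ls. of_bool (v \<in> tips L) :: nat)"

lemma odd_tip_simps [simp]:
  "\<not> odd_tip [] v"
  "odd_tip (L # Ls) v \<longleftrightarrow> (v \<in> tips L) \<noteq> odd_tip Ls v"
  by (auto simp: odd_tip_def)

lemma odd_tip_append [simp]: "odd_tip (Ls @ Ks) v \<longleftrightarrow> odd_tip Ls v \<noteq> odd_tip Ks v"
  by (induction Ls) auto

lemma odd_tip_nth:
  assumes "odd_tip Ls v"
  shows "\<exists>j<length Ls. v \<in> tips (Ls ! j)"
proof -
  have "\<exists>L\<in>set Ls. v \<in> tips L" using assms by (induction Ls) auto
  then show ?thesis by (auto simp: in_set_conv_nth)
qed

lemma extend_nth:
  assumes "\<forall>L\<in>set Ls. path_system L" and j: "j < length Ls"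
    and "b \<in> set (concat (Ls ! j)) \<longrightarrow> b \<in> tips (Ls ! j)" "y \<notin> set (concat (Ls ! j))" "y \<noteq> b"
  shows "\<exists>L'. (\<forall>L\<in>set (Ls[j := L']). path_system L) \<and>
    (\<Sum>L\<leftarrow>Ls[j := L']. system_mset L) = add_mset {b, y} (\<Sum>L\<leftarrow>Ls. system_mset L) \<and>
    set (concat L') = insert b (insert y (set (concat (Ls ! j)))) \<and>
    (\<forall>v. v \<in> tips L' \<longleftrightarrow> (v \<in> tips (Ls ! j)) \<noteq> (v = b \<or> v = y)) \<and>
    (\<forall>v. odd_tip (Ls[j := L']) v \<longleftrightarrow> odd_tip Ls v \<noteq> (v = b \<or> v = y))"
proof -
  obtain L' where L': "path_system L'" "system_mset L' = add_mset {b, y} (system_mset (Ls ! j))"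
    "set (concat L') = insert b (insert y (set (concat (Ls ! j))))"
    "\<And>v. v \<in> tips L' \<longleftrightarrow> (v \<in> tips (Ls ! j)) \<noteq> (v = b \<or> v = y)"
    using path_system_extend[of "Ls ! j" b y] assms by (metis nth_mem)
  define As Bs where "As = take j Ls" and "Bs = drop (Suc j) Ls"
  have Ls: "Ls = As @ Ls ! j # Bs" unfolding As_def Bs_def by (rule id_take_nth_drop[OF j])
  have upd: "Ls[j := L'] = As @ L' # Bs" unfolding As_def Bs_def by (rule upd_conv_take_nth_drop[OF j])
  have "\<forall>L\<in>set (Ls[j := L']). path_system L"
    using assms(1) L'(1) set_update_subset_insert[of Ls j L'] by blast
  moreover have "(\<Sum>L\<leftarrow>Ls[j := L']. system_mset L) = add_mset {b, y} (\<Sum>L\<leftarrow>Ls. system_mset L)"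
    unfolding upd using L'(2) by (subst Ls) simp
  moreover have "odd_tip (Ls[j := L']) v \<longleftrightarrow> odd_tip Ls v \<noteq> (v = b \<or> v = y)" for v
    unfolding upd using L'(4)[of v] by (subst Ls) auto
  ultimately show ?thesis using L'(3,4) by blast
qed

text \<open>Joining two ends \<open>v\<close> and \<open>w\<close> of the first forest by a path through two new vertices \<open>y\<close> and \<open>y'\<close>
  has to be compensated for in the other forests. The end edges of that path extend forests that end
  in \<open>v\<close> and \<open>w\<close>, and the middle edge goes to a forest avoiding \<open>y'\<close>, so no cycle arises.\<close>

lemma absorb_joint:
  fixes Ls :: "'a list list list"
  assumes len: "2 \<le> length Ls" and sys: "\<forall>L\<in>set Ls. path_system L \<and> set (concat L) \<subseteq> U"
    and v: "odd_tip Ls v" and w: "odd_tip Ls w" and "v \<noteq> w"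
    and y: "y \<notin> U" "y' \<notin> U" "y \<noteq> y'"
  shows "\<exists>Ls'. length Ls' = length Ls \<and>
    (\<forall>L\<in>set Ls'. path_system L \<and> set (concat L) \<subseteq> insert y (insert y' U)) \<and>
    (\<Sum>L\<leftarrow>Ls'. system_mset L) = (\<Sum>L\<leftarrow>Ls. system_mset L) + {#{v, y}, {y, y'}, {y', w}#} \<and>
    (\<forall>u. odd_tip Ls' u \<longleftrightarrow> odd_tip Ls u \<noteq> (u = v \<or> u = w))"
proof -
  have inU: "set (concat (Ls ! i)) \<subseteq> U" "path_system (Ls ! i)" if "i < length Ls" for i
    using sys that by auto
  obtain j where j: "j < length Ls" "v \<in> tips (Ls ! j)" using odd_tip_nth[OF v] by blast
  have vU: "v \<in> U" using j tips_subset[OF inU(2)[OF j(1)]] inU(1)[OF j(1)] by blast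
  obtain j0 where j0: "j0 < length Ls" "w \<in> tips (Ls ! j0)" using odd_tip_nth[OF w] by blast
  have wU: "w \<in> U" using j0 tips_subset[OF inU(2)[OF j0(1)]] inU(1)[OF j0(1)] by blast
  have "y \<notin> set (concat (Ls ! j))" "y \<noteq> v" using inU(1)[OF j(1)] y(1) vU by auto
  then obtain A where A: "\<forall>L\<in>set (Ls[j := A]). path_system L"
    "(\<Sum>L\<leftarrow>Ls[j := A]. system_mset L) = add_mset {v, y} (\<Sum>L\<leftarrow>Ls. system_mset L)"
    "set (concat A) = insert v (insert y (set (concat (Ls ! j))))"
    "\<forall>u. u \<in> tips A \<longleftrightarrow> (u \<in> tips (Ls ! j)) \<noteq> (u = v \<or> u = y)"
    "\<forall>u. odd_tip (Ls[j := A]) u \<longleftrightarrow> odd_tip Ls u \<noteq> (u = v \<or> u = y)"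
    using extend_nth[of Ls j v y] sys j by blast
  define Ls1 where "Ls1 = Ls[j := A]"
  have len1: "length Ls1 = length Ls" by (simp add: Ls1_def)
  have in1: "set (concat (Ls1 ! i)) \<subseteq> insert y U" if "i < length Ls" for i
    using that inU(1)[of i] inU(1)[OF j(1)] A(3) vU by (cases "i = j") (auto simp: Ls1_def)
  \<comment> \<open>\<open>y\<close> is an end wherever it occurs, so any forest avoiding
    \<open>y'\<close> can take the edge \<open>{y, y'}\<close>.\<close>
  have y1: "y \<in> set (concat (Ls1 ! i)) \<longrightarrow> y \<in> tips (Ls1 ! i)" if i: "i < length Ls" for i
  proof (cases "i = j")
    case True
    have "y \<notin> tips (Ls ! j)" using tips_subset[OF inU(2)[OF j(1)]] inU(1)[OF j(1)] y(1) by blast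
    then show ?thesis using True A(4) j(1) by (simp add: Ls1_def)
  next
    case False
    then show ?thesis using inU(1)[OF i] y(1) by (auto simp: Ls1_def)
  qed
  \<comment> \<open>The first extension leaves the parity at \<open>w\<close> alone, so
    \<open>w\<close> is still an end of some forest, possibly of the one just extended.\<close>
  have "odd_tip Ls1 w" using A(5) w \<open>v \<noteq> w\<close> wU y(1) unfolding Ls1_def by blast
  then obtain j' where j': "j' < length Ls" "w \<in> tips (Ls1 ! j')" using odd_tip_nth len1 by metis
  have "y' \<notin> set (concat (Ls1 ! j'))" "y' \<noteq> w" using in1[OF j'(1)] y(2,3) wU by auto
  then obtain B where B: "\<forall>L\<in>set (Ls1[j' := B]). path_system L"
    "(\<Sum>L\<leftarrow>Ls1[j' := B]. system_mset L) = add_mset {w, y'} (\<Sum>L\<leftarrow>Ls1. system_mset L)"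
    "set (concat B) = insert w (insert y' (set (concat (Ls1 ! j'))))"
    "\<forall>u. odd_tip (Ls1[j' := B]) u \<longleftrightarrow> odd_tip Ls1 u \<noteq> (u = w \<or> u = y')"
    using extend_nth[of Ls1 j' w y'] A(1) j' len1 unfolding Ls1_def by metis
  define Ls2 where "Ls2 = Ls1[j' := B]"
  have len2: "length Ls2 = length Ls" by (simp add: Ls2_def len1)
  \<comment> \<open>Only the forest at \<open>j'\<close> contains \<open>y'\<close>; having at least
    two forests leaves another one for the middle edge.\<close>
  obtain l where l: "l < length Ls" "l \<noteq> j'"
    using len by (metis One_nat_def Suc_1 Suc_le_lessD less_trans zero_less_Suc zero_neq_one)
  have Ls2l: "Ls2 ! l = Ls1 ! l" using l by (simp add: Ls2_def)
  have "y' \<notin> set (concat (Ls2 ! l))" unfolding Ls2l using in1[OF l(1)] y(2,3) by auto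
  then obtain C where C: "\<forall>L\<in>set (Ls2[l := C]). path_system L"
    "(\<Sum>L\<leftarrow>Ls2[l := C]. system_mset L) = add_mset {y, y'} (\<Sum>L\<leftarrow>Ls2. system_mset L)"
    "set (concat C) = insert y (insert y' (set (concat (Ls2 ! l))))"
    "\<forall>u. odd_tip (Ls2[l := C]) u \<longleftrightarrow> odd_tip Ls2 u \<noteq> (u = y \<or> u = y')"
    using extend_nth[of Ls2 l y y'] B(1) y1[OF l(1)] y(3) l(1) len2 Ls2l unfolding Ls2_def by metis
  define Ls3 where "Ls3 = Ls2[l := C]"
  have in2: "set (concat (Ls2 ! i)) \<subseteq> insert y (insert y' U)" if "i < length Ls" for i
    using that in1[of i] in1[OF j'(1)] B(3) wU len1 by (cases "i = j'") (auto simp: Ls2_def)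
  have in3: "set (concat (Ls3 ! i)) \<subseteq> insert y (insert y' U)" if "i < length Ls" for i
    using that in2[of i] in2[OF l(1)] C(3) len2 by (cases "i = l") (auto simp: Ls3_def)
  have len3: "length Ls3 = length Ls" by (simp add: Ls3_def len2)
  have "\<forall>L\<in>set Ls3. set (concat L) \<subseteq> insert y (insert y' U)"
    using in3 len3 by (metis in_set_conv_nth)
  moreover have "(\<Sum>L\<leftarrow>Ls3. system_mset L) = (\<Sum>L\<leftarrow>Ls. system_mset L) + {#{v, y}, {y, y'}, {y', w}#}"
    using A(2) B(2) C(2) by (simp add: Ls3_def Ls2_def Ls1_def insert_commute)
  \<comment> \<open>The parities at \<open>y\<close> and \<open>y'\<close> flip twice, so only those
    at \<open>v\<close> and \<open>w\<close> change.\<close>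
  moreover have "odd_tip Ls3 u \<longleftrightarrow> odd_tip Ls u \<noteq> (u = v \<or> u = w)" for u
    using A(5) B(4) C(4) y vU wU \<open>v \<noteq> w\<close> unfolding Ls3_def[symmetric] Ls2_def[symmetric] Ls1_def[symmetric]
    by (cases "u = y"; cases "u = y'") auto
  ultimately show ?thesis using C(1) len3 unfolding Ls3_def[symmetric] by blast
qed

text \<open>Every joint of two paths of \<open>L\<close> removes the same two vertices from the tips
  of \<open>L\<close> and from the odd tips of \<open>Ls\<close>, which keeps the hypothesis on
  \<open>odd_tip\<close> alive. The last joint closes the one remaining path. All joint edges enter
  both the cycle and the other forests, whence \<open>X\<close> twice.\<close>

lemma absorb_path_system:
  fixes Ls :: "'a list list list"
  assumes inf: "infinite (UNIV :: 'a set)"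
    and "path_system L" "L \<noteq> []" "2 \<le> length Ls" "finite U" "set (concat L) \<subseteq> U"
    "\<forall>L\<in>set Ls. path_system L \<and> set (concat L) \<subseteq> U" "\<forall>v. odd_tip Ls v \<longleftrightarrow> v \<in> tips L"
  shows "\<exists>c Ls' W X. finite W \<and> U \<subseteq> W \<and> is_cycle W c \<and> length Ls' = length Ls \<and>
    (\<forall>L\<in>set Ls'. path_system L \<and> set (concat L) \<subseteq> W) \<and> (\<forall>v. \<not> odd_tip Ls' v) \<and>
    cycle_mset c + (\<Sum>L\<leftarrow>Ls'. system_mset L) = system_mset L + (\<Sum>L\<leftarrow>Ls. system_mset L) + X + X"
  using assms(2-)
proof (induction "length L" arbitrary: L Ls U rule: less_induct)
  case less
  obtain p L' where L: "L = p # L'" using less.prems(2) by (cases L) auto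
  obtain y where y: "y \<notin> U" using ex_new_if_finite[OF inf less.prems(4)] by blast
  obtain y' where y': "y' \<notin> insert y U"
    using ex_new_if_finite[OF inf, of "insert y U"] less.prems(4) by auto
  have p: "distinct p" "2 \<le> length p" "set p \<subseteq> U" using less.prems(1,5) by (auto simp: L)
  note hl = long_path_hd_last(1-3)[OF p(2)] long_path_hd_last(4)[OF p(2,1)]
  define V where "V = insert y (insert y' U)"
  show ?case
  proof (cases L')
    case Nil
    have "odd_tip Ls (last p)" "odd_tip Ls (hd p)" using less.prems(7) by (auto simp: L)
    then obtain Ks where Ks: "length Ks = length Ls"
      "\<forall>L\<in>set Ks. path_system L \<and> set (concat L) \<subseteq> V"
      "(\<Sum>L\<leftarrow>Ks. system_mset L) = (\<Sum>L\<leftarrow>Ls. system_mset L) + {#{last p, y}, {y, y'}, {y', hd p}#}"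
      "\<forall>u. odd_tip Ks u \<longleftrightarrow> odd_tip Ls u \<noteq> (u = last p \<or> u = hd p)"
      using absorb_joint[OF less.prems(3,6), of "last p" "hd p" y y'] y y' hl(4) unfolding V_def by auto
    have "is_cycle V (p @ [y, y'])"
      using p y y' by (auto simp: is_cycle_def V_def)
    moreover have "cycle_mset (p @ [y, y']) = path_mset p + {#{last p, y}, {y, y'}, {y', hd p}#}"
      using hl(1) by (simp add: cycle_mset_def path_mset_append)
    moreover have "\<forall>u. \<not> odd_tip Ks u" using Ks(4) less.prems(7) by (auto simp: L Nil)
    ultimately show ?thesis using Ks(1-3) less.prems(4)
      by (intro exI[of _ "p @ [y, y']"] exI[of _ Ks] exI[of _ V]
          exI[of _ "{#{last p, y}, {y, y'}, {y', hd p}#}"]) (auto simp: V_def L Nil)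
  next
    case (Cons q L'')
    have q: "distinct q" "2 \<le> length q" "set q \<subseteq> U" "set p \<inter> set q = {}"
      using less.prems(1,5) by (auto simp: L Cons)
    note hlq = long_path_hd_last(1-3)[OF q(2)] long_path_hd_last(4)[OF q(2,1)]
    have tip: "last p \<notin> tips L''" "hd q \<notin> tips L''"
      using less.prems(1) tips_subset[of L''] hl(3) hlq(2) by (auto simp: L Cons)
    have neq: "last p \<noteq> hd q" "last p \<noteq> last q" "hd p \<noteq> hd q" 
      using q(4) hl(2,3) hlq(2,3) by (metis disjoint_iff)+
    have "odd_tip Ls (last p)" "odd_tip Ls (hd q)" using less.prems(7) by (auto simp: L Cons)
    then obtain Ks where Ks: "length Ks = length Ls"
      "\<forall>L\<in>set Ks. path_system L \<and> set (concat L) \<subseteq> V"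
      "(\<Sum>L\<leftarrow>Ks. system_mset L) = (\<Sum>L\<leftarrow>Ls. system_mset L) + {#{last p, y}, {y, y'}, {y', hd q}#}"
      "\<forall>u. odd_tip Ks u \<longleftrightarrow> odd_tip Ls u \<noteq> (u = last p \<or> u = hd q)"
      using absorb_joint[OF less.prems(3,6), of "last p" "hd q" y y'] y y' neq(1) unfolding V_def by auto
    define K where "K = (p @ [y, y'] @ q) # L''"
    have "path_system K"
      using less.prems(1,5) y y' p q by (auto simp: K_def L Cons)
    moreover have "set (concat K) \<subseteq> V" using less.prems(5) by (auto simp: K_def V_def L Cons)
    moreover have "odd_tip Ks u \<longleftrightarrow> u \<in> tips K" for u
    proof -
      have "u \<in> tips L \<longleftrightarrow> u \<in> {hd p, last p, hd q, last q} \<or> u \<in> tips L''" by (auto simp: L Cons)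
      moreover have "u \<in> tips K \<longleftrightarrow> u \<in> {hd p, last q} \<or> u \<in> tips L''"
        using hl(1) hlq(1) by (auto simp: K_def)
      ultimately show ?thesis
        unfolding Ks(4)[rule_format] less.prems(7)[rule_format] using tip neq hl(4) hlq(4)
        by (cases "u = last p"; cases "u = hd q") auto
    qed
    moreover have "finite V" using less.prems(4) by (simp add: V_def)
    moreover have "length K < length L" "K \<noteq> []" by (simp_all add: K_def L Cons)
    ultimately obtain c Ls' W X where IH: "finite W" "V \<subseteq> W" "is_cycle W c" "length Ls' = length Ks"
      "\<forall>L\<in>set Ls'. path_system L \<and> set (concat L) \<subseteq> W" "\<forall>v. \<not> odd_tip Ls' v"
      "cycle_mset c + (\<Sum>L\<leftarrow>Ls'. system_mset L) = system_mset K + (\<Sum>L\<leftarrow>Ks. system_mset L) + X + X"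
      using less.hyps[of K Ks V] less.prems(3) Ks(1,2) by metis
    have "system_mset K = system_mset L + {#{last p, y}, {y, y'}, {y', hd q}#}"
      using hl(1) hlq(1) by (simp add: K_def L Cons path_mset_append path_mset_Cons)
    then have "cycle_mset c + (\<Sum>L\<leftarrow>Ls'. system_mset L) = system_mset L + (\<Sum>L\<leftarrow>Ls. system_mset L)
        + (X + {#{last p, y}, {y, y'}, {y', hd q}#}) + (X + {#{last p, y}, {y, y'}, {y', hd q}#})"
      using IH(7) Ks(3) by simp
    moreover have "U \<subseteq> W" using IH(2) by (auto simp: V_def)
    ultimately show ?thesis using IH(1,3-6) Ks(1) by metis
  qed
qed

text \<open>Even parity everywhere makes the tips of the first forest the odd tips of the others, as
  absorbing it requires. Absorption takes two other forests; with one other the tips agree, and a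
  forest on its own has no tips and hence no path.\<close>

lemma covered_path_systems:
  fixes Ls :: "'a list list list"
  assumes inf: "infinite (UNIV :: 'a set)"
    and "finite U" "\<forall>L\<in>set Ls. path_system L \<and> set (concat L) \<subseteq> U" "\<forall>v. \<not> odd_tip Ls v"
  shows "\<exists>W. finite W \<and> U \<subseteq> W \<and> covered W (length Ls) (\<Sum>L\<leftarrow>Ls. system_mset L)"
  using assms(2-)
proof (induction "length Ls" arbitrary: Ls U)
  case 0
  then show ?case by auto
next
  case (Suc n)
  obtain L Ks where Ls: "Ls = L # Ks" using Suc.hyps(2) by (cases Ls) auto
  have L: "path_system L" "set (concat L) \<subseteq> U" using Suc.prems(2) by (auto simp: Ls)
  have tip: "odd_tip Ks v \<longleftrightarrow> v \<in> tips L" for v using Suc.prems(3) by (auto simp: Ls)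
  have IH: "\<exists>W. finite W \<and> V \<subseteq> W \<and> covered W n (\<Sum>L\<leftarrow>Js. system_mset L)"
    if "length Js = n" "finite V" "\<forall>L\<in>set Js. path_system L \<and> set (concat L) \<subseteq> V" "\<forall>v. \<not> odd_tip Js v"
    for Js :: "'a list list list" and V using Suc.hyps(1)[of Js V] that by blast
  have n: "length Ks = n" "length Ls = Suc n" using Suc.hyps(2) by (simp_all add: Ls)
  consider "L = []" | "L \<noteq> []" "n = 0" | "L \<noteq> []" "n = 1" | "L \<noteq> []" "2 \<le> n" by linarith
  then show ?case
  proof cases
    case 1
    then have "\<forall>v. \<not> odd_tip Ks v" using tip by simp
    then obtain W where "finite W" "U \<subseteq> W" "covered W n (\<Sum>L\<leftarrow>Ks. system_mset L)"
      using IH[of Ks U] n Suc.prems by (auto simp: Ls)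
    then show ?thesis using covered_mono[of W n _ "Suc n" W] n 1 by (auto simp: Ls)
  next
    case 2
    then have "tips L = {}" using tip n by auto
    then show ?thesis using card_tips[OF L(1)] 2 by simp
  next
    case 3
    then obtain K where K: "Ks = [K]" using n by (auto simp: length_Suc_conv)
    have "tips L = tips K" using tip by (auto simp: K)
    then show ?thesis
      using covered_two_path_systems[OF inf Suc.prems(1) L(1), of K] L(2) Suc.prems(2)
      by (simp add: Ls K numeral_2_eq_2)
  next
    case 4
    have "\<forall>L\<in>set Ks. path_system L \<and> set (concat L) \<subseteq> U" using Suc.prems(2) by (simp add: Ls)
    then obtain c Ls' W X where A: "finite W" "U \<subseteq> W" "is_cycle W c" "length Ls' = length Ks"
      "\<forall>L\<in>set Ls'. path_system L \<and> set (concat L) \<subseteq> W" "\<forall>v. \<not> odd_tip Ls' v"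
      "cycle_mset c + (\<Sum>L\<leftarrow>Ls'. system_mset L) = system_mset L + (\<Sum>L\<leftarrow>Ks. system_mset L) + X + X"
      using absorb_path_system[OF inf L(1) 4(1) _ Suc.prems(1) L(2), of Ks] tip 4(2) n by metis
    obtain W' where W': "finite W'" "W \<subseteq> W'" "covered W' n (\<Sum>L\<leftarrow>Ls'. system_mset L)"
      using IH[of Ls' W] A n by auto
    have "covered W' 1 (cycle_mset c)"
      using covered_mono[OF covered_cycle[OF A(3)] _ W'(2), of 1] by simp
    from covered_add[OF this W'(3)]
    have "covered W' (1 + n) (system_mset L + (\<Sum>L\<leftarrow>Ks. system_mset L))"
      unfolding A(7) covered_cong[OF odd_part_double] .
    then show ?thesis using W'(1,2) A(2) n by (auto simp: Ls)
  qed
qed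

subsection \<open>Linear forests as systems of paths\<close>

lemma sum_mset_set_UN:
  assumes "finite I" "\<And>i. i \<in> I \<Longrightarrow> finite (A i)" "disjoint_family_on A I"
  shows "(\<Sum>i\<in>I. mset_set (A i)) = mset_set (\<Union>i\<in>I. A i)"
  using assms
proof (induction I rule: finite_induct)
  case (insert i I)
  have "disjoint_family_on A I" "A i \<inter> (\<Union>j\<in>I. A j) = {}"
    using insert.prems(2) insert.hyps(2) by (auto simp: disjoint_family_on_def)
  then show ?case using insert by (simp add: mset_set_Union)
qed simp

lemma component_eq:
  assumes "w \<in> component G v"
  shows "component G w = component G v"
proof -
  let ?R = "{(x, y). {x, y} \<in> edges G}"
  have "sym ?R" by (auto simp: sym_def insert_commute)
  then have "sym (?R\<^sup>*)" by (rule sym_rtrancl)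
  moreover have "(v, w) \<in> ?R\<^sup>*" using assms by (simp add: component_def)
  ultimately have "(v, w) \<in> ?R\<^sup>*" "(w, v) \<in> ?R\<^sup>*" by (auto dest: symD)
  then show ?thesis unfolding component_def by (auto intro: rtrancl_trans)
qed

text \<open>One list is taken for every component; components with one vertex carry no edge and are
  dropped.\<close>

lemma linear_forest_path_system:
  assumes "linear_forest G"
  shows "\<exists>L. path_system L \<and> set (concat L) \<subseteq> verts G \<and> system_mset L = mset_set (edges G)"
proof -
  have simple: "simple_graph G" using assms by (simp add: linear_forest_def)
  have finV: "finite (verts G)" and finE: "finite (edges G)"
    using simple simple_graph_finite_edges by (auto simp: simple_graph_def)
  define \<K> where "\<K> = component G ` verts G"
  have "\<forall>K\<in>\<K>. \<exists>vs. distinct vs \<and> set vs = K \<and> path_edges vs = {e \<in> edges G. e \<subseteq> K}"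
    using assms by (auto simp: \<K>_def linear_forest_def)
  then obtain f where f: "\<And>K. K \<in> \<K> \<Longrightarrow> distinct (f K) \<and> set (f K) = K \<and>
      path_edges (f K) = {e \<in> edges G. e \<subseteq> K}"
    by metis
  have self: "v \<in> component G v" for v by (simp add: component_def)
  have disj: "K \<inter> K' = {}" if "K \<in> \<K>" "K' \<in> \<K>" "K \<noteq> K'" for K K'
    using that component_eq[of _ G] unfolding \<K>_def by (metis (no_types, lifting) disjoint_iff imageE)
  have sub: "component G v \<subseteq> verts G" if "v \<in> verts G" for v
  proof
    fix w assume "w \<in> component G v"
    then have "(v, w) \<in> {(x, y). {x, y} \<in> edges G}\<^sup>*" by (simp add: component_def)
    then show "w \<in> verts G"
      by (induction rule: rtrancl_induct) (use that simple in \<open>auto simp: simple_graph_def\<close>)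
  qed
  have edge: "{e \<in> edges G. e \<subseteq> K} \<inter> {e \<in> edges G. e \<subseteq> K'} = {}"
    if "K \<in> \<K>" "K' \<in> \<K>" "K \<noteq> K'" for K K'
  proof -
    have False if "e \<in> edges G" "e \<subseteq> K" "e \<subseteq> K'" for e
    proof -
      have "card e = 2" using simple that(1) by (simp add: simple_graph_def)
      then have "e \<noteq> {}" by auto
      then show False using disj[OF \<open>K \<in> \<K>\<close> \<open>K' \<in> \<K>\<close> \<open>K \<noteq> K'\<close>] that by blast
    qed
    then show ?thesis by blast
  qed
  have cover: "(\<Union>K\<in>\<K>. {e \<in> edges G. e \<subseteq> K}) = edges G"
  proof -
    have "\<exists>K\<in>\<K>. e \<subseteq> K" if e: "e \<in> edges G" for e
    proof -
      have e': "e \<subseteq> verts G" "card e = 2" using e simple by (auto simp: simple_graph_def)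
      then obtain x y where xy: "e = {x, y}" by (auto simp: card_2_iff)
      have "y \<in> component G x" using e unfolding component_def xy by auto
      then have "e \<subseteq> component G x" using self by (simp add: xy)
      then show ?thesis using e'(1) unfolding \<K>_def xy by blast
    qed
    then show ?thesis by blast
  qed
  have "finite \<K>" using finV by (simp add: \<K>_def)
  then obtain Ks where Ks: "set Ks = \<K>" "distinct Ks" using finite_distinct_list by blast
  define L where "L = filter (\<lambda>p. 2 \<le> length p) (map f Ks)"
  have "distinct (concat (filter P (map f Js)))" if "set Js \<subseteq> \<K>" "distinct Js" for Js P
    using that
  proof (induction Js)
    case (Cons K Js)
    have K: "K \<in> \<K>" and Js: "set Js \<subseteq> \<K>" "K \<notin> set Js" "distinct Js" using Cons.prems by auto
    have "K \<inter> set (f J) = {}" if "J \<in> set Js" for J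
    proof -
      have "J \<in> \<K>" "K \<noteq> J" using that Js by auto
      then show ?thesis using disj[OF K] f[of J] by metis
    qed
    then have "set (f K) \<inter> set (concat (filter P (map f Js))) = {}" using f[OF K] by auto
    then show ?case using Cons.IH[OF Js(1,3)] f[OF K] by simp
  qed simp
  then have "path_system L" using Ks by (auto simp: path_system_def L_def)
  moreover have "set (concat L) \<subseteq> verts G"
  proof -
    have "set (f K) \<subseteq> verts G" if "K \<in> \<K>" for K
    proof -
      obtain v where "v \<in> verts G" "K = component G v" using \<open>K \<in> \<K>\<close> by (auto simp: \<K>_def)
      then show ?thesis using f[OF that] sub by simp
    qed
    then show ?thesis by (auto simp: L_def Ks)
  qed
  moreover have "system_mset L = mset_set (edges G)"
  proof -
    have short: "path_mset p = {#}" if "\<not> 2 \<le> length p" for p :: "'a list"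
      using that by (cases p rule: path_mset.cases) auto
    have "system_mset (filter (\<lambda>p. 2 \<le> length p) ps) = system_mset ps" for ps :: "'a list list"
      by (induction ps) (auto simp: short)
    then have "system_mset L = (\<Sum>K\<leftarrow>Ks. path_mset (f K))"
      by (simp add: L_def comp_def)
    also have "\<dots> = (\<Sum>K\<in>\<K>. path_mset (f K))" using Ks by (simp add: sum_list_distinct_conv_sum_set)
    also have "\<dots> = (\<Sum>K\<in>\<K>. mset_set {e \<in> edges G. e \<subseteq> K})"
      using f by (intro sum.cong) (simp_all add: path_mset_distinct)
    also have "\<dots> = mset_set (\<Union>K\<in>\<K>. {e \<in> edges G. e \<subseteq> K})"
      using \<open>finite \<K>\<close> finE edge by (intro sum_mset_set_UN) (auto simp: disjoint_family_on_def)
    finally show ?thesis using cover by simp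
  qed
  ultimately show ?thesis by blast
qed

section \<open>Parity of ends and the bound by the linear arboricity\<close>

text \<open>The exclusive or accounts for the path on one vertex, whose two ends coincide and have
  degree 0.\<close>

lemma odd_path_degree:
  "distinct p \<Longrightarrow> p \<noteq> [] \<Longrightarrow> odd (size {#e \<in># path_mset p. v \<in> e#}) \<longleftrightarrow> (v = hd p) \<noteq> (v = last p)"
  by (induction p rule: path_mset.induct) auto

lemma odd_system_degree:
  "path_system L \<Longrightarrow> odd (size {#e \<in># system_mset L. v \<in> e#}) \<longleftrightarrow> v \<in> tips L"
proof (induction L)
  case (Cons p L)
  show ?case using Cons path_system_Cons_tips[OF Cons.prems] odd_path_degree[of p v] by auto
qed simp

text \<open>This ties the tips to the degrees: in a decomposition of an Eulerian graph no vertex is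
  an odd tip.\<close>

lemma odd_tip_degree:
  "\<forall>L\<in>set Ls. path_system L \<Longrightarrow> odd_tip Ls v \<longleftrightarrow> odd (size {#e \<in># (\<Sum>L\<leftarrow>Ls. system_mset L). v \<in> e#})"
proof (induction Ls)
  case (Cons L Ls)
  then show ?case using odd_system_degree[of L v] by auto
qed simp

text \<open>Each decomposition into forests yields at most as many cycles. The vertices used for
  closing become isolated vertices in \<open>W\<close>; the sum type supplies them even if the type
  of \<open>G\<close> is finite.\<close>

lemma c2_iso_le_la:
  fixes G :: "'a graph"
  assumes G: "simple_graph G" "eulerian G"
  shows "c2_iso G \<le> la G"
  unfolding la_def
proof (rule INF_greatest)
  fix \<F> assume "\<F> \<in> {\<F>. finite \<F> \<and> disjoint \<F> \<and> \<Union>\<F> = edges G \<and>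
                         (\<forall>F\<in>\<F>. linear_forest (Graph (verts G) F))}"
  then have \<F>: "finite \<F>" "disjoint \<F>" "\<Union>\<F> = edges G" "\<And>F. F \<in> \<F> \<Longrightarrow> linear_forest (Graph (verts G) F)"
    by auto
  have finE: "finite (edges G)" by (rule simple_graph_finite_edges[OF G(1)])
  have "\<forall>F\<in>\<F>. \<exists>L. path_system L \<and> set (concat L) \<subseteq> verts G \<and> system_mset L = mset_set F"
    using linear_forest_path_system[OF \<F>(4)] by auto
  then obtain f where f: "\<And>F. F \<in> \<F> \<Longrightarrow>
      path_system (f F) \<and> set (concat (f F)) \<subseteq> verts G \<and> system_mset (f F) = mset_set F"
    by metis
  obtain Fs where Fs: "set Fs = \<F>" "distinct Fs" using finite_distinct_list[OF \<F>(1)] by blast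
  define Ls :: "('a + nat) list list list" where "Ls = map (\<lambda>F. map (map Inl) (f F)) Fs"
  have "(\<Sum>F\<leftarrow>Fs. system_mset (f F)) = (\<Sum>F\<in>\<F>. mset_set F)"
    using Fs f by (simp add: sum_list_distinct_conv_sum_set)
  \<comment> \<open>Disjointness of the forests keeps the multiset sum free of repetitions.\<close>
  also have "\<dots> = mset_set (edges G)"
  proof -
    have "finite F" if "F \<in> \<F>" for F
      using finite_subset[OF _ finE, of F] that \<F>(3) by auto
    moreover have "disjoint_family_on (\<lambda>F. F) \<F>"
      using disjointD[OF \<F>(2)] by (simp add: disjoint_family_on_def)
    ultimately show ?thesis
      using sum_mset_set_UN[of \<F> "\<lambda>F. F"] \<F>(1,3) by simp
  qed
  finally have "(\<Sum>F\<leftarrow>Fs. system_mset (f F)) = mset_set (edges G)" .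
  then have sum: "(\<Sum>L\<leftarrow>Ls. system_mset L) = mset_set (edges (embed G))"
    by (simp add: mset_set_edges_embed Ls_def comp_def path_mset_map flip: image_mset_sum_list)
  have sys: "path_system L \<and> set (concat L) \<subseteq> verts (embed G)" if L: "L \<in> set Ls" for L
  proof -
    obtain F where F: "F \<in> \<F>" "L = map (map Inl) (f F)" using L Fs by (auto simp: Ls_def)
    have "distinct (concat L)"
      using f[OF F(1)] by (simp add: F(2) path_system_def distinct_map flip: map_concat)
    then show ?thesis
      using f[OF F(1)] by (auto simp: F(2) path_system_def embed_def)
  qed
  have "even (degree (embed G) v)" for v
  proof (cases "v \<in> verts (embed G)")
    case True
    then show ?thesis using G(2) degree_embed[of G] by (auto simp: embed_def eulerian_def)
  next
    case False
    then have "{e \<in> edges (embed G). v \<in> e} = {}"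
      using simple_graph_embed[OF G(1)] by (auto simp: simple_graph_def)
    then show ?thesis unfolding degree_def by (metis card.empty even_zero)
  qed
  moreover have finE': "finite (edges (embed G))"
    by (rule simple_graph_finite_edges[OF simple_graph_embed[OF G(1)]])
  ultimately have "\<not> odd_tip Ls v" for v
    using odd_tip_degree[of Ls v] sys unfolding sum by (simp add: degree_def)
  moreover have "finite (verts (embed G))"
    using simple_graph_embed[OF G(1)] by (simp add: simple_graph_def)
  moreover have "infinite (UNIV :: ('a + nat) set)" by simp
  ultimately obtain W where W: "finite W" "verts (embed G) \<subseteq> W"
    "covered W (length Ls) (mset_set (edges (embed G)))"
    using covered_path_systems[of "verts (embed G)" Ls] sys sum by metis
  have "c2_iso G \<le> c2 (Graph W (edges (embed G)))"
    unfolding c2_iso_def using W(1,2) by (intro INF_lower) simp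
  also have "\<dots> \<le> enat (length Ls)"
    using W(3) odd_part_mset_set[OF finE'] by (intro c2_le_covered) simp_all
  also have "length Ls = card \<F>" using Fs by (simp add: Ls_def distinct_card[symmetric])
  finally show "c2_iso G \<le> enat (card \<F>)" .
qed

theorem theorem1p4:
  fixes G :: "'a graph"
  assumes "simple_graph G" and "eulerian G"
  shows "(\<not> union_of_disjoint_cycles G \<longrightarrow> c2_top G = enat (max_degree G div 2)) \<and>
         c2_iso G \<le> la G \<and>
         c2 G \<le> enat (max_degree G)"
  using c2_top_le_max_degree[OF assms] max_degree_le_c2_top[OF assms(1)] c2_iso_le_la[OF assms]
    c2_le_max_degree[OF assms] by (auto intro: antisym)

end
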